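(* Let $\mathcal{J}(u)=0$ for all $u\in X_s$. Then the semi-discrete mixed formulation $$M\,d_t a(t)=J(a(t))\,b(t)+G(a(t))\,c(t),\qquad M b(t)-\nabla H(a(t))=0,\qquad M c(t)-\nabla S(a(t))=0$$ satisfies the following: 1. It is a consistent semi-discretised form of the continuous gradient flow system $\partial_t u=\mathcal{G}(u)\delta\mathcal{S}(u)$: it is the Galerkin restriction to $V_N$ of the mixed formulation of that system. 2. It is a finite-dimensional gradient flow for the entropy $S$: it is equivalent to $d_t a=\widehat{G}(a)\nabla S(a)$, where $\widehat{G}(a)=M^{-1}G(a)M^{-1}$ is symmetric positive semi-definite for every $a\in\mathbb{R}^N$.
   Context: Hilbert scale: $X_0$ is a separable real Hilbert space with scalar product $\langle\cdot,\cdot\rangle_0$ and Hilbert basis $\{\psi_k\}_{k\in\mathbb{Z}}$; $\{\theta_k\}_{k\in\mathbb{Z}}$ is a positive sequence with $\theta_k\to\infty$ as $|k|\to\infty$; for $r\in\mathbb{Z}$, $X_r$ is the Hilbert space with norm $\|u\|_r^2=\sum_k|\langle u,\psi_k\rangle_0|^2\theta_k^{2r}$ (a completion when $r<0$). The scalar product extends to a duality pairing $X_r\times X_{-r}\to\mathbb{R}$, still denoted $\langle\cdot,\cdot\rangle_0$. Let $s,d,e\in\mathbb{N}\setminus\{0\}$ with $2s\ge d,e$, so that $X_s$ is dense in $X_{-s+d}$ and in $X_{-s+e}$. Continuous problem: $\partial_t u=\mathcal{J}(u)\delta\mathcal{H}(u)+\mathcal{G}(u)\delta\mathcal{S}(u)$,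 $u(0)=u_0\in X_s$, with $\mathcal{H},\mathcal{S}:X_s\to\mathbb{R}$ of class $C^1$; $\delta\mathcal{F}(u)$ is defined by $\langle\delta\mathcal{F}(u),\xi\rangle_0=\mathsf{d}\mathcal{F}(u)\xi$ for all $\xi\in X_s$, with $\delta\mathcal{H}(u)\in X_{-s+d}$, $\delta\mathcal{S}(u)\in X_{-s+e}$. For each $u\in X_s$, $\mathcal{J}(u):X_{-s+d}\to X_{-s}$ is linear and skew-adjoint, and $\mathcal{G}(u):X_{-s+e}\to X_{-s}$ is linear, self-adjoint and positive semi-definite, with respect to $\langle\cdot,\cdot\rangle_0$. Mixed formulation: for all $v\in X_s$, $\langle\partial_t u,v\rangle_0=-\langle z,\mathcal{J}(u)v\rangle_0+\langle y,\mathcal{G}(u)v\rangle_0$, $\langle z-\delta\mathcal{H}(u),v\rangle_0=0$, $\langle y-\delta\mathcal{S}(u),v\rangle_0=0$. Discretisation: $V_N\subset X_s$ is a finite-dimensional subspace with basis $v_1,\dots,v_N$. The unknowns are $u_N=\sum_i a_i v_i$, $z_N=\sum_i b_i v_i$, $y_N=\sum_i c_i v_i$ with $a,b,c:\mathcal{T}\to\mathbb{R}^N$, and test functions are taken in $V_N$. For $a\in\mathbb{R}^N$ and $u_N=\sum_i a_iv_i$: $H(a)=\mathcal{H}(u_N)$, $S(a)=\mathcal{S}(u_N)$, $M_{i,j}=\langle v_j,v_i\rangle_0$, $J(a)_{i,j}=\langle\mathcal{J}(u_N)v_j,v_i\rangle_0$, $G(a)_{i,j}=\langle\mathcal{G}(u_N)v_j,v_i\rangle_0$.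 *)

theory Defs
  imports "HOL-Analysis.Analysis"
begin

section \<open>The Hilbert scale\<close>

text \<open>
  All spaces \<open>X\<^sub>r\<close> live in one real vector space of formal series \<open>\<Sum>\<^sub>k c\<^sub>k \<psi>\<^sub>k\<close>, represented by
  their coefficients, so that \<open>X\<^sub>p \<subseteq> X\<^sub>q\<close> for \<open>q \<le> p\<close> is an honest inclusion. An element \<open>x\<close> of
  the given space \<open>X\<^sub>0\<close> is identified with the series with coefficients \<open>x \<bullet> \<psi>\<^sub>k\<close>.
\<close>

typedef hvec = "UNIV :: (int \<Rightarrow> real) set"
  morphisms coeff Abs_hvec ..

lemma coeff_Abs_hvec [simp]: "coeff (Abs_hvec c) = c"
  by (simp add: Abs_hvec_inverse)

lemma hvec_eqI: "(\<And>k. coeff u k = coeff w k) \<Longrightarrow> u = w"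
  by (metis coeff_inject ext)

instantiation hvec :: real_vector
begin

definition "0 = Abs_hvec (\<lambda>k. 0)"
definition "u + w = Abs_hvec (\<lambda>k. coeff u k + coeff w k)"
definition "- u = Abs_hvec (\<lambda>k. - coeff u k)"
definition "u - w = Abs_hvec (\<lambda>k. coeff u k - coeff w k)"
definition "c *\<^sub>R u = Abs_hvec (\<lambda>k. c * coeff u k)"

instance
  by standard
    (auto intro!: hvec_eqI simp: zero_hvec_def plus_hvec_def uminus_hvec_def minus_hvec_def
      scaleR_hvec_def algebra_simps)

end

lemma coeff_simps [simp]:
  "coeff 0 k = 0" "coeff (u + w) k = coeff u k + coeff w k" "coeff (- u) k = - coeff u k"
  "coeff (u - w) k = coeff u k - coeff w k" "coeff (c *\<^sub>R u) k = c * coeff u k"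
  by (simp_all add: zero_hvec_def plus_hvec_def uminus_hvec_def minus_hvec_def scaleR_hvec_def)

lemma coeff_sum [simp]: "coeff (sum f A) k = (\<Sum>i\<in>A. coeff (f i) k)"
  by (induction A rule: infinite_finite_induct) auto

definition hilbert_basis :: "(int \<Rightarrow> 'a::real_inner) \<Rightarrow> bool" where
  "hilbert_basis \<psi> \<longleftrightarrow>
    (\<forall>j k. \<psi> j \<bullet> \<psi> k = (if j = k then 1 else 0)) \<and> closure (span (range \<psi>)) = UNIV"

text \<open>On the integers, the cofinite filter expresses \<open>\<bar>k\<bar> \<rightarrow> \<infinity>\<close>.\<close>

definition scale_weights :: "(int \<Rightarrow> real) \<Rightarrow> bool" where
  "scale_weights \<theta> \<longleftrightarrow> (\<forall>k. 0 < \<theta> k) \<and> filterlim \<theta> at_top cofinite"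

definition hvec_of :: "(int \<Rightarrow> 'a::real_inner) \<Rightarrow> 'a \<Rightarrow> hvec" where
  "hvec_of \<psi> x = Abs_hvec (\<lambda>k. x \<bullet> \<psi> k)"

definition hs_norm :: "(int \<Rightarrow> real) \<Rightarrow> int \<Rightarrow> hvec \<Rightarrow> real" where
  "hs_norm \<theta> r u = sqrt (\<Sum>\<^sub>\<infinity>k. (coeff u k)\<^sup>2 * \<theta> k powi (2 * r))"

text \<open>
  For \<open>r < 0\<close> the set below is the completion of \<open>X\<^sub>0\<close> in the norm \<open>hs_norm \<theta> r\<close>: it contains
  \<open>X\<^sub>0\<close> as a dense subspace (\<open>hs_space_0\<close>, \<open>hs_space_mono\<close>, \<open>hs_space_dense\<close> below) and it is
  complete (\<open>hs_space_complete\<close>).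
\<close>

definition hs_space :: "(int \<Rightarrow> 'a::real_inner) \<Rightarrow> (int \<Rightarrow> real) \<Rightarrow> int \<Rightarrow> hvec set" where
  "hs_space \<psi> \<theta> r =
    (if 0 \<le> r then hvec_of \<psi> ` {x. (\<lambda>k. (x \<bullet> \<psi> k)\<^sup>2 * \<theta> k powi (2 * r)) summable_on UNIV}
     else {u. (\<lambda>k. (coeff u k)\<^sup>2 * \<theta> k powi (2 * r)) summable_on UNIV})"

text \<open>
  The extension of the scalar product of \<open>X\<^sub>0\<close> to the pairings \<open>X\<^sub>r \<times> X\<^sub>-\<^sub>r \<rightarrow> \<real>\<close>; see
  \<open>pairing_hvec_of\<close> and \<open>pairing_bound\<close>.
\<close>

definition pairing :: "hvec \<Rightarrow> hvec \<Rightarrow> real" where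
  "pairing u w = (\<Sum>\<^sub>\<infinity>k. coeff u k * coeff w k)"


section \<open>Calculus and operators on the scale\<close>

definition linear_between :: "hvec set \<Rightarrow> hvec set \<Rightarrow> (hvec \<Rightarrow> hvec) \<Rightarrow> bool" where
  "linear_between X Y L \<longleftrightarrow> (\<forall>x\<in>X. L x \<in> Y) \<and>
    (\<forall>x\<in>X. \<forall>y\<in>X. L (x + y) = L x + L y) \<and> (\<forall>c. \<forall>x\<in>X. L (c *\<^sub>R x) = c *\<^sub>R L x)"

text \<open>
  Let \<open>L : X \<rightarrow> Y\<close>, and let \<open>X'\<close>, \<open>Y'\<close> be the spaces in duality with \<open>X\<close>, \<open>Y\<close>. The adjoint of
  \<open>L\<close> for the pairing maps \<open>Y'\<close> to \<open>X'\<close>; with \<open>Y' \<subseteq> X\<close>, the map \<open>L\<close> is self-adjoint (skew-adjoint) if its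
  restriction to \<open>Y'\<close> is this adjoint (minus this adjoint). The condition \<open>L w \<in> X'\<close> makes \<open>\<langle>x, L w\<rangle>\<close> meaningful.
\<close>

definition self_adjoint_pairing :: "hvec set \<Rightarrow> hvec set \<Rightarrow> hvec set \<Rightarrow> (hvec \<Rightarrow> hvec) \<Rightarrow> bool" where
  "self_adjoint_pairing X X' Y' L \<longleftrightarrow>
    (\<forall>w\<in>Y'. L w \<in> X') \<and> (\<forall>x\<in>X. \<forall>w\<in>Y'. pairing (L x) w = pairing x (L w))"

definition skew_adjoint_pairing :: "hvec set \<Rightarrow> hvec set \<Rightarrow> hvec set \<Rightarrow> (hvec \<Rightarrow> hvec) \<Rightarrow> bool" where
  "skew_adjoint_pairing X X' Y' L \<longleftrightarrow>
    (\<forall>w\<in>Y'. L w \<in> X') \<and> (\<forall>x\<in>X. \<forall>w\<in>Y'. pairing (L x) w = - pairing x (L w))"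

definition positive_semidefinite_pairing :: "hvec set \<Rightarrow> (hvec \<Rightarrow> hvec) \<Rightarrow> bool" where
  "positive_semidefinite_pairing Y' L \<longleftrightarrow> (\<forall>w\<in>Y'. 0 \<le> pairing (L w) w)"

text \<open>Frechet differentiability of \<open>F\<close> on the space \<open>X\<close> with norm \<open>n\<close>.\<close>

definition frechet_deriv_on ::
  "hvec set \<Rightarrow> (hvec \<Rightarrow> real) \<Rightarrow> (hvec \<Rightarrow> real) \<Rightarrow> hvec \<Rightarrow> (hvec \<Rightarrow> real) \<Rightarrow> bool" where
  "frechet_deriv_on X n F u L \<longleftrightarrow>
    (\<forall>x\<in>X. \<forall>y\<in>X. L (x + y) = L x + L y) \<and> (\<forall>c. \<forall>x\<in>X. L (c *\<^sub>R x) = c * L x) \<and>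
    (\<exists>B. \<forall>x\<in>X. \<bar>L x\<bar> \<le> B * n x) \<and>
    (\<forall>\<epsilon>>0. \<exists>\<delta>>0. \<forall>\<xi>\<in>X. n \<xi> < \<delta> \<longrightarrow> \<bar>F (u + \<xi>) - F u - L \<xi>\<bar> \<le> \<epsilon> * n \<xi>)"

definition C1_functional :: "hvec set \<Rightarrow> (hvec \<Rightarrow> real) \<Rightarrow> (hvec \<Rightarrow> real) \<Rightarrow> bool" where
  "C1_functional X n F \<longleftrightarrow> (\<exists>DF. (\<forall>u\<in>X. frechet_deriv_on X n F u (DF u)) \<and>
    (\<forall>u\<in>X. \<forall>\<epsilon>>0. \<exists>\<delta>>0. \<forall>w\<in>X. n (w - u) < \<delta> \<longrightarrow> (\<forall>\<xi>\<in>X. \<bar>DF w \<xi> - DF u \<xi>\<bar> \<le> \<epsilon> * n \<xi>)))"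

definition variational_derivative ::
  "hvec set \<Rightarrow> (hvec \<Rightarrow> real) \<Rightarrow> (hvec \<Rightarrow> real) \<Rightarrow> hvec \<Rightarrow> hvec \<Rightarrow> bool" where
  "variational_derivative X n F u g \<longleftrightarrow>
    (\<exists>L. frechet_deriv_on X n F u L \<and> (\<forall>\<xi>\<in>X. pairing g \<xi> = L \<xi>))"

text \<open>\<open>w\<close> is the time derivative at \<open>t\<close>, relative to the time set \<open>T\<close>, in the space \<open>X\<close> with norm \<open>n\<close>.\<close>

definition has_time_derivative ::
  "hvec set \<Rightarrow> (hvec \<Rightarrow> real) \<Rightarrow> real set \<Rightarrow> (real \<Rightarrow> hvec) \<Rightarrow> hvec \<Rightarrow> real \<Rightarrow> bool" where
  "has_time_derivative X n T u w t \<longleftrightarrow> w \<in> X \<and> (\<forall>\<tau>\<in>T. u \<tau> \<in> X) \<and>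
    ((\<lambda>\<tau>. n ((1 / (\<tau> - t)) *\<^sub>R (u \<tau> - u t) - w)) \<longlongrightarrow> 0) (at t within T)"


section \<open>Continuous problem\<close>

definition evolution_solution ::
  "hvec set \<Rightarrow> (hvec \<Rightarrow> real) \<Rightarrow> hvec set \<Rightarrow> real set \<Rightarrow> (hvec \<Rightarrow> hvec) \<Rightarrow> (real \<Rightarrow> hvec) \<Rightarrow> bool" where
  "evolution_solution X n U T F u \<longleftrightarrow>
    (\<forall>t\<in>T. u t \<in> U \<and> has_time_derivative X n T u (F (u t)) t)"

text \<open>
  The mixed formulation with the unknowns \<open>u\<close>, \<open>z\<close>, \<open>y\<close> sought in \<open>U\<close>, \<open>Z\<close>, \<open>Y\<close> and tested against
  \<open>V\<close>; the time derivative is taken in \<open>X\<close> with norm \<open>n\<close>. Its Galerkin restriction to a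
  subspace \<open>W\<close> is obtained by replacing all of \<open>U\<close>, \<open>Z\<close>, \<open>Y\<close>, \<open>V\<close> by \<open>W\<close>.
\<close>

definition mixed_solution ::
  "hvec set \<Rightarrow> (hvec \<Rightarrow> real) \<Rightarrow> real set \<Rightarrow>
   (hvec \<Rightarrow> hvec \<Rightarrow> hvec) \<Rightarrow> (hvec \<Rightarrow> hvec \<Rightarrow> hvec) \<Rightarrow> (hvec \<Rightarrow> hvec) \<Rightarrow> (hvec \<Rightarrow> hvec) \<Rightarrow>
   hvec set \<Rightarrow> hvec set \<Rightarrow> hvec set \<Rightarrow> hvec set \<Rightarrow>
   (real \<Rightarrow> hvec) \<Rightarrow> (real \<Rightarrow> hvec) \<Rightarrow> (real \<Rightarrow> hvec) \<Rightarrow> bool" where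
  "mixed_solution X n T \<J> \<G> \<delta>H \<delta>S U Z Y V u z y \<longleftrightarrow>
    (\<forall>t\<in>T. u t \<in> U \<and> z t \<in> Z \<and> y t \<in> Y \<and>
      (\<exists>w. has_time_derivative X n T u w t \<and>
        (\<forall>v\<in>V. pairing w v = - pairing (z t) (\<J> (u t) v) + pairing (y t) (\<G> (u t) v))) \<and>
      (\<forall>v\<in>V. pairing (z t - \<delta>H (u t)) v = 0) \<and>
      (\<forall>v\<in>V. pairing (y t - \<delta>S (u t)) v = 0))"

definition galerkin_mixed_solution ::
  "hvec set \<Rightarrow> (hvec \<Rightarrow> real) \<Rightarrow> real set \<Rightarrow>
   (hvec \<Rightarrow> hvec \<Rightarrow> hvec) \<Rightarrow> (hvec \<Rightarrow> hvec \<Rightarrow> hvec) \<Rightarrow> (hvec \<Rightarrow> hvec) \<Rightarrow> (hvec \<Rightarrow> hvec) \<Rightarrow>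
   hvec set \<Rightarrow> (real \<Rightarrow> hvec) \<Rightarrow> (real \<Rightarrow> hvec) \<Rightarrow> (real \<Rightarrow> hvec) \<Rightarrow> bool" where
  "galerkin_mixed_solution X n T \<J> \<G> \<delta>H \<delta>S W u z y \<longleftrightarrow>
    mixed_solution X n T \<J> \<G> \<delta>H \<delta>S W W W W u z y"


section \<open>Discretisation\<close>

definition lincomb :: "('n::finite \<Rightarrow> hvec) \<Rightarrow> real ^ 'n \<Rightarrow> hvec" where
  "lincomb v a = (\<Sum>i\<in>UNIV. (a $ i) *\<^sub>R v i)"

definition mass_matrix :: "('n::finite \<Rightarrow> hvec) \<Rightarrow> real ^ 'n ^ 'n" where
  "mass_matrix v = (\<chi> i j. pairing (v j) (v i))"

definition operator_matrix ::
  "('n::finite \<Rightarrow> hvec) \<Rightarrow> (hvec \<Rightarrow> hvec \<Rightarrow> hvec) \<Rightarrow> real ^ 'n \<Rightarrow> real ^ 'n ^ 'n" where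
  "operator_matrix v L a = (\<chi> i j. pairing (L (lincomb v a) (v j)) (v i))"

definition reduced_functional :: "('n::finite \<Rightarrow> hvec) \<Rightarrow> (hvec \<Rightarrow> real) \<Rightarrow> real ^ 'n \<Rightarrow> real" where
  "reduced_functional v F a = F (lincomb v a)"

definition gradient :: "('a::real_inner \<Rightarrow> real) \<Rightarrow> 'a \<Rightarrow> 'a" where
  "gradient f a = (THE g. GDERIV f a :> g)"

definition semi_discrete_solution ::
  "real ^ 'n ^ 'n \<Rightarrow> (real ^ 'n \<Rightarrow> real ^ 'n ^ 'n) \<Rightarrow> (real ^ 'n \<Rightarrow> real ^ 'n ^ 'n) \<Rightarrow>
   (real ^ 'n \<Rightarrow> real) \<Rightarrow> (real ^ 'n \<Rightarrow> real) \<Rightarrow> real set \<Rightarrow>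
   (real \<Rightarrow> real ^ 'n) \<Rightarrow> (real \<Rightarrow> real ^ 'n) \<Rightarrow> (real \<Rightarrow> real ^ 'n) \<Rightarrow> bool" where
  "semi_discrete_solution M J G H S T a b c \<longleftrightarrow>
    (\<forall>t\<in>T. (\<exists>a'. (a has_vector_derivative a') (at t within T) \<and>
               M *v a' = J (a t) *v b t + G (a t) *v c t) \<and>
      M *v b t - gradient H (a t) = 0 \<and> M *v c t - gradient S (a t) = 0)"

definition ode_solution ::
  "(real ^ 'n \<Rightarrow> real ^ 'n) \<Rightarrow> real set \<Rightarrow> (real \<Rightarrow> real ^ 'n) \<Rightarrow> bool" where
  "ode_solution f T a \<longleftrightarrow> (\<forall>t\<in>T. (a has_vector_derivative f (a t)) (at t within T))"

definition G_hat ::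
  "real ^ 'n ^ 'n \<Rightarrow> (real ^ 'n \<Rightarrow> real ^ 'n ^ 'n) \<Rightarrow> real ^ 'n \<Rightarrow> real ^ 'n ^ 'n" where
  "G_hat M G a = matrix_inv M ** G a ** matrix_inv M"

definition symmetric_psd :: "real ^ 'n ^ 'n \<Rightarrow> bool" where
  "symmetric_psd A \<longleftrightarrow> transpose A = A \<and> (\<forall>x. 0 \<le> x \<bullet> (A *v x))"


section \<open>Basic facts about the scale\<close>

lemma has_sum_dist_iff:
  fixes l :: "'b::{metric_space, comm_monoid_add}"
  shows "(f has_sum l) A \<longleftrightarrow> (\<forall>e>0. \<exists>X. finite X \<and> X \<subseteq> A \<and>
    (\<forall>Y. finite Y \<and> X \<subseteq> Y \<and> Y \<subseteq> A \<longrightarrow> dist (sum f Y) l < e))"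
  by (simp add: has_sum_def tendsto_iff eventually_finite_subsets_at_top)

lemma hilbert_basis_expansion:
  assumes "hilbert_basis \<psi>"
  shows "((\<lambda>k. (x \<bullet> \<psi> k) *\<^sub>R \<psi> k) has_sum x) UNIV"
proof -
  have ortho: "\<psi> j \<bullet> \<psi> k = (if j = k then 1 else 0)" for j k
    using assms by (simp add: hilbert_basis_def)
  define P where "P F = (\<Sum>k\<in>F. (x \<bullet> \<psi> k) *\<^sub>R \<psi> k)" for F
  have P_inner: "P F \<bullet> \<psi> k = x \<bullet> \<psi> k" if "finite F" "k \<in> F" for F k
    using that by (simp add: P_def inner_sum_left ortho if_distrib cong: if_cong)
  have best: "norm (x - P F) \<le> norm (x - (\<Sum>k\<in>F. c k *\<^sub>R \<psi> k))" if "finite F" for F and c :: "int \<Rightarrow> real"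
  proof -
    define q where "q = P F - (\<Sum>k\<in>F. c k *\<^sub>R \<psi> k)"
    have "(x - P F) \<bullet> \<psi> k = 0" if "k \<in> F" for k
      using P_inner[OF \<open>finite F\<close> that] by (simp add: inner_diff_left)
    then have "(x - P F) \<bullet> q = 0"
      unfolding q_def P_def[of F] sum_subtractf[symmetric] scaleR_left_diff_distrib[symmetric]
      by (simp add: inner_sum_right P_def)
    then have "(norm (x - P F + q))\<^sup>2 = (norm (x - P F))\<^sup>2 + (norm q)\<^sup>2"
      by (simp add: norm_add_Pythagorean orthogonal_def)
    then have "(norm (x - P F))\<^sup>2 \<le> (norm (x - P F + q))\<^sup>2"
      by simp
    then have "norm (x - P F) \<le> norm (x - P F + q)"
      by (rule power2_le_imp_le) simp
    then show ?thesis
      by (simp add: q_def)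
  qed
  show ?thesis
    unfolding has_sum_dist_iff
  proof (intro allI impI)
    fix e :: real assume "0 < e"
    have "x \<in> closure (span (range \<psi>))"
      using assms by (simp add: hilbert_basis_def)
    then obtain y where y: "y \<in> span (range \<psi>)" "dist y x < e"
      using \<open>0 < e\<close> closure_approachable by blast
    from y(1) obtain S r where S: "finite S" "S \<subseteq> range \<psi>" and y_eq: "y = (\<Sum>a\<in>S. r a *\<^sub>R a)"
      unfolding span_explicit by blast
    have "inj \<psi>"
      using ortho by (metis injI zero_neq_one)
    obtain F0 where F0: "finite F0" "S = \<psi> ` F0"
      using S finite_subset_image by (metis)
    have y_eq': "y = (\<Sum>k\<in>F0. r (\<psi> k) *\<^sub>R \<psi> k)"
      using F0 \<open>inj \<psi>\<close> unfolding y_eq by (simp add: sum.reindex inj_on_subset)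
    have "dist (sum (\<lambda>k. (x \<bullet> \<psi> k) *\<^sub>R \<psi> k) F) x < e" if "finite F" "F0 \<subseteq> F" for F
    proof -
      define c where "c k = (if k \<in> F0 then r (\<psi> k) else 0)" for k
      have "(\<Sum>k\<in>F. c k *\<^sub>R \<psi> k) = (\<Sum>k\<in>F0. r (\<psi> k) *\<^sub>R \<psi> k)"
        using that by (intro sum.mono_neutral_cong_right) (auto simp: c_def)
      then have "norm (x - P F) \<le> norm (x - y)"
        using best[OF \<open>finite F\<close>, of c] y_eq' by simp
      then show ?thesis
        using y(2) by (simp add: P_def dist_norm norm_minus_commute)
    qed
    then show "\<exists>X. finite X \<and> X \<subseteq> UNIV \<and>
        (\<forall>Y. finite Y \<and> X \<subseteq> Y \<and> Y \<subseteq> UNIV \<longrightarrow> dist (\<Sum>k\<in>Y. (x \<bullet> \<psi> k) *\<^sub>R \<psi> k) x < e)"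
      using F0(1) by blast
  qed
qed

lemma parseval:
  assumes "hilbert_basis \<psi>"
  shows "((\<lambda>k. (x \<bullet> \<psi> k) * (y \<bullet> \<psi> k)) has_sum (x \<bullet> y)) UNIV"
  using has_sum_bounded_linear[OF bounded_linear_inner_left[of y] hilbert_basis_expansion[OF assms, of x]]
  by (simp add: o_def inner_commute)

lemma riesz_fischer:
  fixes \<psi> :: "int \<Rightarrow> 'a::{real_inner, complete_space}"
  assumes "hilbert_basis \<psi>" and "(\<lambda>k. (c k)\<^sup>2) summable_on UNIV"
  obtains x where "\<And>k. x \<bullet> \<psi> k = c k"
proof -
  have ortho: "\<psi> j \<bullet> \<psi> k = (if j = k then 1 else 0)" for j k
    using assms by (simp add: hilbert_basis_def)
  have norm_sum: "(norm (\<Sum>k\<in>F. c k *\<^sub>R \<psi> k))\<^sup>2 = (\<Sum>k\<in>F. (c k)\<^sup>2)" if "finite F" for F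
  proof -
    have "(\<Sum>k\<in>F. c k *\<^sub>R \<psi> k) \<bullet> \<psi> j = c j" if "j \<in> F" for j
      using \<open>finite F\<close> that by (simp add: inner_sum_left ortho if_distrib cong: if_cong)
    then show ?thesis
      by (simp add: power2_norm_eq_inner inner_sum_right power2_eq_square[of "c _"])
  qed
  have "(\<lambda>k. c k *\<^sub>R \<psi> k) summable_on UNIV"
  proof -
    define I where "I = (\<Sum>\<^sub>\<infinity>k. (c k)\<^sup>2)"
    have hs: "((\<lambda>k. (c k)\<^sup>2) has_sum I) UNIV"
      using assms(2) by (simp add: I_def)
    have "\<exists>F. finite F \<and> (\<forall>G. finite G \<and> F \<subseteq> G \<longrightarrow> dist (\<Sum>k\<in>G. (c k)\<^sup>2) I < inverse (Suc n))" for n :: nat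
      using hs[unfolded has_sum_dist_iff] by (auto simp del: of_nat_Suc)
    then obtain F where F: "\<And>n. finite (F n)"
      and F_close: "\<And>n G. finite G \<Longrightarrow> F n \<subseteq> G \<Longrightarrow> dist (\<Sum>k\<in>G. (c k)\<^sup>2) I < inverse (Suc n)"
      by metis
    define A where "A n = (\<Union>i\<le>n. F i)" for n
    have A: "finite (A n)" "F n \<subseteq> A n" "mono A" for n
      using F by (auto simp: A_def mono_def intro: order_trans)
    have tail: "(norm ((\<Sum>k\<in>G. c k *\<^sub>R \<psi> k) - (\<Sum>k\<in>A n. c k *\<^sub>R \<psi> k)))\<^sup>2 < 2 * inverse (Suc n)"
      if "finite G" "A n \<subseteq> G" for G n
    proof -
      have "(norm ((\<Sum>k\<in>G. c k *\<^sub>R \<psi> k) - (\<Sum>k\<in>A n. c k *\<^sub>R \<psi> k)))\<^sup>2 = (\<Sum>k\<in>G - A n. (c k)\<^sup>2)"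
        using norm_sum[of "G - A n"] that by (simp add: sum_diff)
      also have "\<dots> = (\<Sum>k\<in>G. (c k)\<^sup>2) - (\<Sum>k\<in>A n. (c k)\<^sup>2)"
        using that by (simp add: sum_diff)
      also have "\<dots> < 2 * inverse (Suc n)"
      proof -
        have "dist (\<Sum>k\<in>G. (c k)\<^sup>2) I < inverse (Suc n)"
          using that A(2) by (intro F_close) auto
        moreover have "dist (\<Sum>k\<in>A n. (c k)\<^sup>2) I < inverse (Suc n)"
          using A by (intro F_close)
        ultimately show ?thesis
          unfolding dist_real_def by linarith
      qed
      finally show ?thesis .
    qed
    have small: "\<exists>n. 2 * inverse (real (Suc n)) < e\<^sup>2" if "0 < e" for e :: real
    proof -
      have "0 < e\<^sup>2 / 2" using that by simp
      from reals_Archimedean[OF this] obtain n where "inverse (real (Suc n)) < e\<^sup>2 / 2" ..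
      then have "2 * inverse (real (Suc n)) < e\<^sup>2" by linarith
      then show ?thesis ..
    qed
    have "Cauchy (\<lambda>n. \<Sum>k\<in>A n. c k *\<^sub>R \<psi> k)"
      unfolding Cauchy_altdef2
    proof (intro allI impI)
      fix e :: real assume "0 < e"
      with small obtain n where n: "2 * inverse (Suc n) < e\<^sup>2" by blast
      have "dist (\<Sum>k\<in>A m. c k *\<^sub>R \<psi> k) (\<Sum>k\<in>A n. c k *\<^sub>R \<psi> k) < e" if "n \<le> m" for m
      proof -
        have "(norm ((\<Sum>k\<in>A m. c k *\<^sub>R \<psi> k) - (\<Sum>k\<in>A n. c k *\<^sub>R \<psi> k)))\<^sup>2 < e\<^sup>2"
          using tail[OF A(1), of n m] n monoD[OF A(3) that] by linarith
        then show ?thesis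
          using \<open>0 < e\<close> by (simp add: dist_norm power_less_imp_less_base)
      qed
      then show "\<exists>N. \<forall>n\<ge>N. dist (\<Sum>k\<in>A n. c k *\<^sub>R \<psi> k) (\<Sum>k\<in>A N. c k *\<^sub>R \<psi> k) < e"
        by blast
    qed
    then obtain x where x: "(\<lambda>n. \<Sum>k\<in>A n. c k *\<^sub>R \<psi> k) \<longlonglongrightarrow> x"
      using Cauchy_convergent convergent_def by blast
    have "((\<lambda>k. c k *\<^sub>R \<psi> k) has_sum x) UNIV"
      unfolding has_sum_dist_iff
    proof (intro allI impI)
      fix e :: real assume "0 < e"
      then have "0 < e / 2" by simp
      with small obtain n where n: "2 * inverse (Suc n) < (e / 2)\<^sup>2" by blast
      have close: "dist (\<Sum>k\<in>G. c k *\<^sub>R \<psi> k) (\<Sum>k\<in>A n. c k *\<^sub>R \<psi> k) < e / 2"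
        if "finite G" "A n \<subseteq> G" for G
      proof -
        have "(norm ((\<Sum>k\<in>G. c k *\<^sub>R \<psi> k) - (\<Sum>k\<in>A n. c k *\<^sub>R \<psi> k)))\<^sup>2 < (e / 2)\<^sup>2"
          using tail[OF that] n by linarith
        then show ?thesis
          using \<open>0 < e / 2\<close> unfolding dist_norm by (meson less_eq_real_def power_less_imp_less_base)
      qed
      have "dist (\<Sum>k\<in>A n. c k *\<^sub>R \<psi> k) x \<le> e / 2"
      proof (rule Lim_dist_ubound[OF _ x])
        show "\<forall>\<^sub>F m in sequentially. dist (\<Sum>k\<in>A n. c k *\<^sub>R \<psi> k) (\<Sum>k\<in>A m. c k *\<^sub>R \<psi> k) \<le> e / 2"
          using eventually_ge_at_top[of n]
        proof eventually_elim
          case (elim m)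
          show ?case
            using close[OF A(1) monoD[OF A(3) elim]] by (simp add: dist_commute)
        qed
      qed simp
      then have "dist (\<Sum>k\<in>G. c k *\<^sub>R \<psi> k) x < e" if "finite G" "A n \<subseteq> G" for G
        using close[OF that] dist_triangle[of "\<Sum>k\<in>G. c k *\<^sub>R \<psi> k" x "\<Sum>k\<in>A n. c k *\<^sub>R \<psi> k"] by linarith
      then show "\<exists>X. finite X \<and> X \<subseteq> UNIV \<and>
          (\<forall>Y. finite Y \<and> X \<subseteq> Y \<and> Y \<subseteq> UNIV \<longrightarrow> dist (\<Sum>k\<in>Y. c k *\<^sub>R \<psi> k) x < e)"
        using A(1) by (intro exI[of _ "A n"]) simp
    qed
    then show ?thesis
      by (auto simp: summable_on_def)
  qed
  then obtain x where x: "((\<lambda>k. c k *\<^sub>R \<psi> k) has_sum x) UNIV"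
    by (auto simp: summable_on_def)
  have "x \<bullet> \<psi> j = c j" for j
  proof -
    have "((\<lambda>k. c k * (\<psi> k \<bullet> \<psi> j)) has_sum (x \<bullet> \<psi> j)) UNIV"
      using has_sum_bounded_linear[OF bounded_linear_inner_left[of "\<psi> j"] x] by (simp add: o_def)
    moreover have "((\<lambda>k. c k * (\<psi> k \<bullet> \<psi> j)) has_sum (c j)) UNIV"
      using has_sum_finite_neutralI[of "{j}" UNIV "\<lambda>k. c k * (\<psi> k \<bullet> \<psi> j)" "c j"] by (simp add: ortho)
    ultimately show ?thesis
      using has_sum_unique by blast
  qed
  then show ?thesis
    using that by blast
qed

lemma coeff_hvec_of [simp]: "coeff (hvec_of \<psi> x) k = x \<bullet> \<psi> k"
  by (simp add: hvec_of_def)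

lemma linear_hvec_of: "linear (hvec_of \<psi>)"
  by (rule linearI) (auto intro!: hvec_eqI simp: inner_add_left)

lemma inj_hvec_of:
  assumes "hilbert_basis \<psi>"
  shows "inj (hvec_of \<psi>)"
proof (rule injI)
  fix x y assume "hvec_of \<psi> x = hvec_of \<psi> y"
  then have "(x - y) \<bullet> \<psi> k = 0" for k
    by (metis coeff_hvec_of inner_diff_left right_minus_eq)
  then show "x = y"
    using parseval[OF assms, of "x - y" "x - y"]
    by (metis (no_types, lifting) UNIV_I eq_iff_diff_eq_0 has_sum_0 has_sum_unique inner_eq_zero_iff mult_zero_left)
qed

lemma pairing_hvec_of:
  assumes "hilbert_basis \<psi>"
  shows "pairing (hvec_of \<psi> x) (hvec_of \<psi> y) = x \<bullet> y"
  using parseval[OF assms, of x y] by (simp add: pairing_def infsumI)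

lemma hs_norm_0:
  assumes "hilbert_basis \<psi>"
  shows "hs_norm \<theta> 0 (hvec_of \<psi> x) = norm x"
  using parseval[OF assms, of x x]
  by (simp add: hs_norm_def power2_eq_square infsumI norm_eq_sqrt_inner)

lemma weight_square: "(c * \<theta> k powi r)\<^sup>2 = c\<^sup>2 * \<theta> k powi (2 * r)" for \<theta> :: "int \<Rightarrow> real"
  by (simp add: power_mult_distrib power_int_mult mult.commute[of 2 r])

lemma hs_space_0:
  assumes "hilbert_basis \<psi>"
  shows "hs_space \<psi> \<theta> 0 = range (hvec_of \<psi>)"
  using parseval[OF assms] by (auto simp: hs_space_def power2_eq_square summable_on_def)

lemma weight_lower_bound:
  assumes "scale_weights \<theta>"
  obtains m where "0 < m" and "\<And>k. m \<le> \<theta> k"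
proof -
  have pos: "0 < \<theta> k" for k using assms by (simp add: scale_weights_def)
  have "\<forall>\<^sub>F k in cofinite. 1 \<le> \<theta> k"
    using assms by (simp add: scale_weights_def filterlim_at_top)
  then have fin: "finite {k. \<not> 1 \<le> \<theta> k}"
    by (simp add: eventually_cofinite)
  define m where "m = Min (insert 1 (\<theta> ` {k. \<not> 1 \<le> \<theta> k}))"
  have "0 < m"
    using fin pos by (auto simp: m_def)
  moreover have "m \<le> \<theta> k" for k
  proof (cases "1 \<le> \<theta> k")
    case True
    have "m \<le> 1" using fin by (simp add: m_def)
    with True show ?thesis by linarith
  next
    case False
    then show ?thesis using fin by (auto simp: m_def intro!: Min_le)
  qed
  ultimately show thesis by (rule that)
qed

lemma weighted_summable_mono:
  assumes "scale_weights \<theta>" and "q \<le> p" and "(\<lambda>k. (c k)\<^sup>2 * \<theta> k powi (2 * p)) summable_on UNIV"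
  shows "(\<lambda>k. (c k)\<^sup>2 * \<theta> k powi (2 * q)) summable_on UNIV"
proof -
  have pos: "0 < \<theta> k" for k using assms by (simp add: scale_weights_def)
  obtain m where m: "0 < m" "\<And>k. m \<le> \<theta> k"
    using weight_lower_bound[OF assms(1)] by blast
  have "\<theta> k powi (2 * q) \<le> m powi (2 * (q - p)) * \<theta> k powi (2 * p)" for k
  proof -
    define n where "n = nat (2 * (p - q))"
    have n: "2 * (q - p) = - int n" using assms(2) by (simp add: n_def)
    have "m ^ n \<le> \<theta> k ^ n" using m by (simp add: power_mono less_imp_le)
    then have "inverse (\<theta> k ^ n) \<le> inverse (m ^ n)"
      using m by (simp add: le_imp_inverse_le)
    then have le: "\<theta> k powi (2 * (q - p)) \<le> m powi (2 * (q - p))"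
      unfolding n by (simp only: power_int_minus power_int_of_nat)
    have "\<theta> k powi (2 * q) = \<theta> k powi (2 * (q - p)) * \<theta> k powi (2 * p)"
      using pos[of k] by (simp add: power_int_add[symmetric] algebra_simps)
    also have "\<dots> \<le> m powi (2 * (q - p)) * \<theta> k powi (2 * p)"
      using le pos[of k] by (intro mult_right_mono) (auto intro: zero_le_power_int less_imp_le)
    finally show ?thesis .
  qed
  then have le: "(c k)\<^sup>2 * \<theta> k powi (2 * q) \<le> m powi (2 * (q - p)) * ((c k)\<^sup>2 * \<theta> k powi (2 * p))" for k
    by (metis mult.left_commute mult_left_mono zero_le_power2)
  have "(\<lambda>k. m powi (2 * (q - p)) * ((c k)\<^sup>2 * \<theta> k powi (2 * p))) summable_on UNIV"
    using assms(3) by (rule summable_on_cmult_right)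
  then show ?thesis
    by (rule summable_on_comparison_test) (use le pos in \<open>auto intro!: mult_nonneg_nonneg zero_le_power_int intro: less_imp_le\<close>)
qed

lemma hs_space_iff:
  fixes \<psi> :: "int \<Rightarrow> 'a::{real_inner, complete_space}"
  assumes "hilbert_basis \<psi>" and "scale_weights \<theta>"
  shows "u \<in> hs_space \<psi> \<theta> r \<longleftrightarrow> (\<lambda>k. (coeff u k)\<^sup>2 * \<theta> k powi (2 * r)) summable_on UNIV"
proof (cases "0 \<le> r")
  case True
  have "u \<in> hs_space \<psi> \<theta> r" if "(\<lambda>k. (coeff u k)\<^sup>2 * \<theta> k powi (2 * r)) summable_on UNIV"
  proof -
    have "(\<lambda>k. (coeff u k)\<^sup>2) summable_on UNIV"
      using weighted_summable_mono[OF assms(2) True that] by simp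
    then obtain x where x: "\<And>k. x \<bullet> \<psi> k = coeff u k"
      using riesz_fischer[OF assms(1)] by blast
    then have "u = hvec_of \<psi> x" by (intro hvec_eqI) simp
    moreover have "(\<lambda>k. (x \<bullet> \<psi> k)\<^sup>2 * \<theta> k powi (2 * r)) summable_on UNIV"
      unfolding x by (rule that)
    ultimately show ?thesis
      using True unfolding hs_space_def by simp
  qed
  moreover have "(\<lambda>k. (coeff u k)\<^sup>2 * \<theta> k powi (2 * r)) summable_on UNIV" if "u \<in> hs_space \<psi> \<theta> r"
  proof -
    from that obtain x where "u = hvec_of \<psi> x"
        and "(\<lambda>k. (x \<bullet> \<psi> k)\<^sup>2 * \<theta> k powi (2 * r)) summable_on UNIV"
      using True unfolding hs_space_def by auto
    then show ?thesis by simp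
  qed
  ultimately show ?thesis by blast
qed (simp add: hs_space_def)

lemma hs_space_mono:
  fixes \<psi> :: "int \<Rightarrow> 'a::{real_inner, complete_space}"
  assumes "hilbert_basis \<psi>" and "scale_weights \<theta>" and "q \<le> p"
  shows "hs_space \<psi> \<theta> p \<subseteq> hs_space \<psi> \<theta> q"
proof
  fix u assume "u \<in> hs_space \<psi> \<theta> p"
  then show "u \<in> hs_space \<psi> \<theta> q"
    unfolding hs_space_iff[OF assms(1,2)] by (rule weighted_summable_mono[OF assms(2,3)])
qed

lemma hs_norm_outside:
  assumes "finite A" and "\<And>k. k \<in> A \<Longrightarrow> coeff u k = 0"
  shows "hs_norm \<theta> r u = sqrt (\<Sum>\<^sub>\<infinity>k\<in>-A. (coeff u k)\<^sup>2 * \<theta> k powi (2 * r))"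
  unfolding hs_norm_def using assms
  by (intro arg_cong[of _ _ sqrt] infsum_cong_neutral) auto

text \<open>Finite sums of basis vectors are dense in every \<open>X\<^sub>r\<close>.\<close>

lemma hs_space_dense:
  fixes \<psi> :: "int \<Rightarrow> 'a::{real_inner, complete_space}"
  assumes "hilbert_basis \<psi>" and "scale_weights \<theta>" and "u \<in> hs_space \<psi> \<theta> r" and "0 < \<epsilon>"
  obtains x where "x \<in> span (range \<psi>)" and "hs_norm \<theta> r (u - hvec_of \<psi> x) < \<epsilon>"
proof -
  have ortho: "\<psi> j \<bullet> \<psi> k = (if j = k then 1 else 0)" for j k
    using assms by (simp add: hilbert_basis_def)
  let ?f = "\<lambda>k. (coeff u k)\<^sup>2 * \<theta> k powi (2 * r)"
  have sm: "?f summable_on UNIV"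
    using assms hs_space_iff by blast
  then have "(?f has_sum infsum ?f UNIV) UNIV" by simp
  then obtain F where F: "finite F" "dist (sum ?f F) (infsum ?f UNIV) < \<epsilon>\<^sup>2"
    using \<open>0 < \<epsilon>\<close> unfolding has_sum_dist_iff by (meson order_refl subset_UNIV zero_less_power)
  define x where "x = (\<Sum>k\<in>F. coeff u k *\<^sub>R \<psi> k)"
  have xk: "x \<bullet> \<psi> k = (if k \<in> F then coeff u k else 0)" for k
    using F(1) by (simp add: x_def inner_sum_left ortho if_distrib cong: if_cong)
  have "infsum ?f UNIV = infsum ?f F + infsum ?f (- F)"
    using infsum_Un_disjoint[of ?f F "- F"] sm F(1) by (simp add: summable_on_subset_banach)
  then have "infsum ?f (- F) < \<epsilon>\<^sup>2"
    using F by (simp add: dist_real_def)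
  moreover have "hs_norm \<theta> r (u - hvec_of \<psi> x) = sqrt (infsum ?f (- F))"
  proof -
    have "infsum (\<lambda>k. (coeff (u - hvec_of \<psi> x) k)\<^sup>2 * \<theta> k powi (2 * r)) (- F) = infsum ?f (- F)"
      by (rule infsum_cong) (simp add: xk)
    then show ?thesis
      by (subst hs_norm_outside[OF F(1)]) (simp_all add: xk)
  qed
  ultimately have "hs_norm \<theta> r (u - hvec_of \<psi> x) < \<epsilon>"
    using \<open>0 < \<epsilon>\<close> by (simp add: real_less_lsqrt)
  moreover have "x \<in> span (range \<psi>)"
    unfolding x_def by (intro span_sum span_scale span_base) auto
  ultimately show thesis using that by blast
qed

lemma hs_space_isometry:
  fixes \<psi> :: "int \<Rightarrow> 'a::{real_inner, complete_space}"
  assumes \<psi>: "hilbert_basis \<psi>" and "scale_weights \<theta>" and "u \<in> hs_space \<psi> \<theta> r"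
  obtains x where "\<And>k. x \<bullet> \<psi> k = coeff u k * \<theta> k powi r"
proof -
  have "(\<lambda>k. (coeff u k * \<theta> k powi r)\<^sup>2) summable_on UNIV"
    using assms(3) unfolding hs_space_iff[OF assms(1,2)] weight_square[of "coeff u _" \<theta>] .
  from riesz_fischer[OF \<psi> this] that show thesis
    by metis
qed

lemma hs_norm_isometry:
  assumes "hilbert_basis \<psi>" and "\<And>k. x \<bullet> \<psi> k = coeff u k * \<theta> k powi r"
  shows "hs_norm \<theta> r u = norm x"
  using hs_norm_0[OF assms(1), of \<theta> x] by (simp add: hs_norm_def assms(2) weight_square)

lemma hs_space_complete:
  fixes \<psi> :: "int \<Rightarrow> 'a::{real_inner, complete_space}"
  assumes \<psi>: "hilbert_basis \<psi>" and \<theta>: "scale_weights \<theta>" and f: "\<And>n. f n \<in> hs_space \<psi> \<theta> r"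
    and cauchy: "\<And>\<epsilon>. 0 < \<epsilon> \<Longrightarrow> \<exists>N. \<forall>m\<ge>N. \<forall>n\<ge>N. hs_norm \<theta> r (f m - f n) < \<epsilon>"
  obtains u where "u \<in> hs_space \<psi> \<theta> r" and "(\<lambda>n. hs_norm \<theta> r (f n - u)) \<longlonglongrightarrow> 0"
proof -
  have pos: "0 < \<theta> k" for k using \<theta> by (simp add: scale_weights_def)
  have "\<exists>x. \<forall>k. x \<bullet> \<psi> k = coeff (f n) k * \<theta> k powi r" for n
    using hs_space_isometry[OF \<psi> \<theta> f] by metis
  then obtain x where x: "\<And>n k. x n \<bullet> \<psi> k = coeff (f n) k * \<theta> k powi r"
    by metis
  have "norm (x m - x n) = hs_norm \<theta> r (f m - f n)" for m n
    by (rule hs_norm_isometry[OF \<psi>, symmetric]) (simp add: inner_diff_left x left_diff_distrib)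
  then have "Cauchy x"
    using cauchy by (simp add: Cauchy_def dist_norm)
  then obtain l where l: "x \<longlonglongrightarrow> l"
    using Cauchy_convergent convergent_def by blast
  define u where "u = Abs_hvec (\<lambda>k. l \<bullet> \<psi> k * \<theta> k powi (- r))"
  have lu: "l \<bullet> \<psi> k = coeff u k * \<theta> k powi r" for k
    using pos[of k] by (simp add: u_def power_int_minus)
  have "(\<lambda>k. (l \<bullet> \<psi> k)\<^sup>2) summable_on UNIV"
    using parseval[OF \<psi>, of l l] by (auto simp: power2_eq_square summable_on_def)
  then have u: "u \<in> hs_space \<psi> \<theta> r"
    by (simp add: lu weight_square hs_space_iff[OF \<psi> \<theta>])
  have eq: "norm (x n - l) = hs_norm \<theta> r (f n - u)" for n
    by (rule hs_norm_isometry[OF \<psi>, symmetric]) (simp add: inner_diff_left x lu left_diff_distrib)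
  moreover have "(\<lambda>n. norm (x n - l)) \<longlonglongrightarrow> 0"
    using l by (simp add: tendsto_norm_zero_iff LIM_zero_iff)
  then have "(\<lambda>n. hs_norm \<theta> r (f n - u)) \<longlonglongrightarrow> 0"
    unfolding eq .
  with u show thesis by (rule that)
qed

lemma pairing_bound:
  fixes \<psi> :: "int \<Rightarrow> 'a::{real_inner, complete_space}"
  assumes \<psi>: "hilbert_basis \<psi>" and \<theta>: "scale_weights \<theta>"
    and u: "u \<in> hs_space \<psi> \<theta> r" and w: "w \<in> hs_space \<psi> \<theta> (- r)"
  shows "(\<lambda>k. coeff u k * coeff w k) summable_on UNIV"
    and "\<bar>pairing u w\<bar> \<le> hs_norm \<theta> r u * hs_norm \<theta> (- r) w"
proof -
  have pos: "0 < \<theta> k" for k using \<theta> by (simp add: scale_weights_def)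
  obtain x where x: "\<And>k. x \<bullet> \<psi> k = coeff u k * \<theta> k powi r"
    using hs_space_isometry[OF \<psi> \<theta> u] by blast
  obtain y where y: "\<And>k. y \<bullet> \<psi> k = coeff w k * \<theta> k powi (- r)"
    using hs_space_isometry[OF \<psi> \<theta> w] by blast
  have "(x \<bullet> \<psi> k) * (y \<bullet> \<psi> k) = coeff u k * coeff w k" for k
    using pos[of k] by (simp add: x y power_int_minus)
  then have sum: "((\<lambda>k. coeff u k * coeff w k) has_sum (x \<bullet> y)) UNIV"
    using parseval[OF \<psi>, of x y] by simp
  then show "(\<lambda>k. coeff u k * coeff w k) summable_on UNIV"
    by (auto simp: summable_on_def)
  have "hs_norm \<theta> r u = norm x" "hs_norm \<theta> (- r) w = norm y"
    by (rule hs_norm_isometry[OF \<psi>], rule x, rule hs_norm_isometry[OF \<psi>], rule y)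
  then show "\<bar>pairing u w\<bar> \<le> hs_norm \<theta> r u * hs_norm \<theta> (- r) w"
    using sum Cauchy_Schwarz_ineq2[of x y] by (simp add: pairing_def infsumI)
qed

end

theory Submission
  imports Defs
begin

text \<open>
  Every \<open>X\<^sub>r\<close> contains the basis vectors, so testing against \<open>X\<^sub>s\<close> separates formal series; with the
  self-adjointness of \<open>\<G>(u)\<close> this turns the weak equations into the strong ones. On the Galerkin space
  all terms of the weak formulation are inner products with the coefficient vectors, via
  \<open>\<langle>w, \<Sum>\<^sub>i x\<^sub>i v\<^sub>i\<rangle> = x \<bullet> (\<langle>w, v\<^sub>i\<rangle>)\<^sub>i\<close>; the mass matrix is the Gram matrix of a linearly independent
  family in \<open>X\<^sub>0\<close>, hence invertible, and \<open>x \<bullet> (M\<^sup>-\<^sup>1 G M\<^sup>-\<^sup>1 x) = \<langle>\<G>(u) w, w\<rangle>\<close> for the element \<open>w\<close> of \<open>V\<^sub>N\<close>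
  with coefficients \<open>M\<^sup>-\<^sup>1 x\<close>.
\<close>

section \<open>The pairing on the scale\<close>

lemma pairing_commute: "pairing u w = pairing w u"
  by (simp add: pairing_def mult.commute)

lemma pairing_zero [simp]: "pairing 0 w = 0" "pairing u 0 = 0"
  by (simp_all add: pairing_def)

text \<open>No summability is required: a nonzero factor does not change summability, and a series
  that is not summable has the default value 0 on both sides.\<close>

lemma pairing_scaleR_left: "pairing (c *\<^sub>R u) w = c * pairing u w"
  unfolding pairing_def by (simp add: mult.assoc infsum_cmult_right')

section \<open>Linear structure and norm bounds of the spaces X_r\<close>

locale hilbert_scale =
  fixes \<psi> :: "int \<Rightarrow> 'a::{real_inner, complete_space}" and \<theta> :: "int \<Rightarrow> real"
  assumes basis: "hilbert_basis \<psi>" and weights: "scale_weights \<theta>"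
begin

text \<open>Multiplying the coefficients by \<open>\<theta> k powi r\<close> carries X_r
  isometrically onto X_0. In this form, closure under sums and the triangle inequality are inherited
  from the inner product space.\<close>

lemma hs_space_iff_isometry:
  "u \<in> hs_space \<psi> \<theta> r \<longleftrightarrow> (\<exists>x. \<forall>k. x \<bullet> \<psi> k = coeff u k * \<theta> k powi r)"
proof
  assume "\<exists>x. \<forall>k. x \<bullet> \<psi> k = coeff u k * \<theta> k powi r"
  then obtain x where x: "\<And>k. x \<bullet> \<psi> k = coeff u k * \<theta> k powi r" by blast
  have "(\<lambda>k. (x \<bullet> \<psi> k)\<^sup>2) summable_on UNIV"
    using parseval[OF basis, of x x] by (auto simp: power2_eq_square summable_on_def)
  then show "u \<in> hs_space \<psi> \<theta> r"
    by (simp add: x weight_square hs_space_iff[OF basis weights])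
qed (metis hs_space_isometry[OF basis weights])

lemma subspace_hs_space: "subspace (hs_space \<psi> \<theta> r)"
proof (rule subspaceI)
  show "0 \<in> hs_space \<psi> \<theta> r"
    unfolding hs_space_iff_isometry by (intro exI[of _ 0]) simp
  fix u w assume "u \<in> hs_space \<psi> \<theta> r" "w \<in> hs_space \<psi> \<theta> r"
  then show "u + w \<in> hs_space \<psi> \<theta> r"
    unfolding hs_space_iff_isometry by (metis coeff_simps(2) distrib_right inner_add_left)
next
  fix u c assume "u \<in> hs_space \<psi> \<theta> r"
  then show "c *\<^sub>R u \<in> hs_space \<psi> \<theta> r"
    unfolding hs_space_iff_isometry by (metis coeff_simps(5) inner_scaleR_left mult.assoc)
qed

lemma lincomb_in_hs_space:
  assumes "\<And>i. v i \<in> hs_space \<psi> \<theta> r"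
  shows "lincomb v a \<in> hs_space \<psi> \<theta> r"
  unfolding lincomb_def
  by (intro subspace_sum[OF subspace_hs_space] subspace_scale[OF subspace_hs_space] assms)

lemma hs_norm_nonneg: "0 \<le> hs_norm \<theta> r u"
  using weights unfolding hs_norm_def scale_weights_def
  by (auto intro!: infsum_nonneg mult_nonneg_nonneg zero_le_power_int intro: less_imp_le)

text \<open>The map from coordinates to X_r is bounded. The triangle inequality is applied to the
  isometric images \<open>x i\<close> in X_0, since \<open>hs_norm\<close> is a plain function and
  not the norm of a type.\<close>

lemma hs_norm_lincomb_le:
  fixes v :: "'n::finite \<Rightarrow> hvec"
  assumes "\<And>i. v i \<in> hs_space \<psi> \<theta> r"
  shows "hs_norm \<theta> r (lincomb v a) \<le> (\<Sum>i\<in>UNIV. hs_norm \<theta> r (v i)) * norm a"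
proof -
  obtain x where x: "\<And>i k. x i \<bullet> \<psi> k = coeff (v i) k * \<theta> k powi r"
    using assms unfolding hs_space_iff_isometry by metis
  have "hs_norm \<theta> r (lincomb v a) = norm (\<Sum>i\<in>UNIV. (a $ i) *\<^sub>R x i)"
    by (rule hs_norm_isometry[OF basis])
      (simp add: inner_sum_left lincomb_def x sum_distrib_right mult.assoc)
  also have "\<dots> \<le> (\<Sum>i\<in>UNIV. norm ((a $ i) *\<^sub>R x i))"
    by (rule norm_sum)
  also have "\<dots> \<le> (\<Sum>i\<in>UNIV. norm a * norm (x i))"
    by (intro sum_mono) (simp add: mult_right_mono component_le_norm_cart)
  also have "\<dots> = (\<Sum>i\<in>UNIV. hs_norm \<theta> r (v i)) * norm a"
    by (simp add: sum_distrib_left[symmetric] mult.commute hs_norm_isometry[OF basis x])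
  finally show ?thesis .
qed

section \<open>Linearity of the pairing between spaces in duality\<close>

lemma pairing_add_left:
  assumes "u \<in> hs_space \<psi> \<theta> r" "u' \<in> hs_space \<psi> \<theta> r" "w \<in> hs_space \<psi> \<theta> (- r)"
  shows "pairing (u + u') w = pairing u w + pairing u' w"
  unfolding pairing_def
  using infsum_add[OF pairing_bound(1)[OF basis weights assms(1,3)]
      pairing_bound(1)[OF basis weights assms(2,3)]]
  by (simp add: distrib_right)

lemma pairing_diff_left:
  assumes "u \<in> hs_space \<psi> \<theta> r" "u' \<in> hs_space \<psi> \<theta> r" "w \<in> hs_space \<psi> \<theta> (- r)"
  shows "pairing (u - u') w = pairing u w - pairing u' w"
proof -
  have "- 1 *\<^sub>R u' \<in> hs_space \<psi> \<theta> r"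
    by (rule subspace_scale[OF subspace_hs_space assms(2)])
  from pairing_add_left[OF assms(1) this assms(3)]
  show ?thesis by (simp add: pairing_scaleR_left[of "- 1", simplified])
qed

lemma pairing_sum_left:
  assumes "\<And>i. i \<in> A \<Longrightarrow> f i \<in> hs_space \<psi> \<theta> r" "w \<in> hs_space \<psi> \<theta> (- r)"
  shows "pairing (\<Sum>i\<in>A. f i) w = (\<Sum>i\<in>A. pairing (f i) w)"
  using assms
proof (induction A rule: infinite_finite_induct)
  case (insert i A)
  then have "pairing (f i + (\<Sum>i\<in>A. f i)) w = pairing (f i) w + pairing (\<Sum>i\<in>A. f i) w"
    by (intro pairing_add_left[of _ r]) (auto intro!: subspace_sum[OF subspace_hs_space])
  with insert show ?case by simp
qed auto

lemma pairing_lincomb_left: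
  assumes "\<And>i. v i \<in> hs_space \<psi> \<theta> r" "w \<in> hs_space \<psi> \<theta> (- r)"
  shows "pairing (lincomb v a) w = (\<Sum>i\<in>UNIV. a $ i * pairing (v i) w)"
  unfolding lincomb_def
  by (subst pairing_sum_left[of _ _ r])
    (auto simp: pairing_scaleR_left assms intro!: subspace_scale[OF subspace_hs_space] assms)

lemma pairing_lincomb_right:
  assumes "\<And>i. v i \<in> hs_space \<psi> \<theta> (- r)" "w \<in> hs_space \<psi> \<theta> r"
  shows "pairing w (lincomb v a) = (\<Sum>i\<in>UNIV. a $ i * pairing w (v i))"
  using pairing_lincomb_left[of v "- r" w] assms by (simp add: pairing_commute[of w])

section \<open>Separation of formal series by the pairing\<close>

lemma hvec_of_basis_in_hs_space: "hvec_of \<psi> (\<psi> j) \<in> hs_space \<psi> \<theta> r"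
  unfolding hs_space_iff_isometry
  \<comment> \<open>With a single nonzero coefficient, the weight acts as one scalar, whatever the
    sign of \<open>r\<close>.\<close>
  using basis by (intro exI[of _ "(\<theta> j powi r) *\<^sub>R \<psi> j"]) (simp add: hilbert_basis_def)

lemma pairing_hvec_of_basis: "pairing u (hvec_of \<psi> (\<psi> j)) = coeff u j"
proof -
  have "pairing u (hvec_of \<psi> (\<psi> j)) = (\<Sum>\<^sub>\<infinity>k\<in>{j}. coeff u k * (\<psi> j \<bullet> \<psi> k))"
    unfolding pairing_def using basis
    by (intro infsum_cong_neutral) (auto simp: hilbert_basis_def)
  then show ?thesis
    using basis by (simp add: hilbert_basis_def)
qed

text \<open>Pairing with a basis vector leaves one term of the series and reads off a coefficient.
  Hence \<open>u\<close> and \<open>u'\<close> may be arbitrary formal series, without any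
  convergence assumption.\<close>

lemma hvec_eqI_pairing:
  assumes "\<And>w. w \<in> hs_space \<psi> \<theta> r \<Longrightarrow> pairing u w = pairing u' w"
  shows "u = u'"
  using assms[OF hvec_of_basis_in_hs_space] by (intro hvec_eqI) (simp add: pairing_hvec_of_basis)

end

section \<open>Galerkin spaces\<close>

lemma linear_lincomb: "linear (lincomb v)"
  by (rule linearI) (simp_all add: lincomb_def scaleR_add_left sum.distrib scaleR_sum_right)

lemma range_lincomb: "range (lincomb v) = span (range v)"
proof
  show "range (lincomb v) \<subseteq> span (range v)"
    by (auto simp: lincomb_def intro!: span_sum span_scale intro: span_base)
  have "v i = lincomb v (axis i 1)" for i
    by (simp add: lincomb_def axis_def if_distrib[of "\<lambda>c. c *\<^sub>R _"] cong: if_cong)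
  then show "span (range v) \<subseteq> range (lincomb v)"
    by (intro span_minimal linear_subspace_image[OF linear_lincomb]) auto
qed

text \<open>Independence of the set \<open>range v\<close> does not see repetitions; together with
  \<open>inj v\<close> it is linear independence of the indexed family.\<close>

lemma lincomb_eq_0D:
  assumes "inj v" and "independent (range v)" and "lincomb v a = 0"
  shows "a = 0"
proof -
  have "(\<Sum>w\<in>range v. a $ inv v w *\<^sub>R w) = 0"
    using assms(3) by (simp add: sum.reindex[OF assms(1)] lincomb_def assms(1))
  then have "a $ inv v (v i) = 0" for i
    using independentD[OF assms(2), of "range v" "\<lambda>w. a $ inv v w" "v i"] by simp
  then show ?thesis
    using assms(1) by (simp add: vec_eq_iff)
qed

section \<open>Inverses, derivatives and gradients in coordinates\<close>

lemma matrix_inv_mult: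
  assumes "invertible A"
  shows "A ** matrix_inv A = mat 1" and "matrix_inv A ** A = mat 1"
  using someI_ex[OF assms[unfolded invertible_def]] by (simp_all add: matrix_inv_def)

text \<open>The difference quotient is the form in which \<open>has_time_derivative\<close> is
  stated, so derivatives of coordinates and of curves in X_{-s} become comparable.\<close>

lemma has_vector_derivative_iff_tendsto:
  "(f has_vector_derivative D) (at t within T) \<longleftrightarrow>
    ((\<lambda>\<tau>. (1 / (\<tau> - t)) *\<^sub>R (f \<tau> - f t)) \<longlongrightarrow> D) (at t within T)"
proof -
  have "norm ((1 / norm (\<tau> - t)) *\<^sub>R (f \<tau> - (f t + (\<tau> - t) *\<^sub>R D))) =
      norm ((1 / (\<tau> - t)) *\<^sub>R (f \<tau> - f t) - D)" if "\<tau> \<noteq> t" for \<tau>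
  proof -
    have "(1 / (\<tau> - t)) *\<^sub>R (f \<tau> - f t) - D = (1 / (\<tau> - t)) *\<^sub>R (f \<tau> - (f t + (\<tau> - t) *\<^sub>R D))"
      using that by (simp add: scaleR_right_diff_distrib scaleR_right_distrib)
    then show ?thesis by simp
  qed
  then have "((\<lambda>\<tau>. norm ((1 / norm (\<tau> - t)) *\<^sub>R (f \<tau> - (f t + (\<tau> - t) *\<^sub>R D)))) \<longlongrightarrow> 0) (at t within T) \<longleftrightarrow>
      ((\<lambda>\<tau>. norm ((1 / (\<tau> - t)) *\<^sub>R (f \<tau> - f t) - D)) \<longlongrightarrow> 0) (at t within T)"
    by (intro Lim_cong_within) auto
  then show ?thesis
    unfolding has_vector_derivative_def has_derivative_within tendsto_norm_zero_iff
    by (simp add: bounded_linear_scaleR_left LIM_zero_iff[of _ D])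
qed

lemma gradient_eqI:
  assumes "GDERIV f a :> g"
  shows "gradient f a = g"
  unfolding gradient_def
proof (rule the_equality)
  show "GDERIV f a :> g" by (rule assms)
next
  fix g' assume "GDERIV f a :> g'"
  then have "(\<lambda>h. h \<bullet> g') = (\<lambda>h. h \<bullet> g)"
    using assms unfolding gderiv_def by (rule has_derivative_unique)
  then show "g' = g"
    by (metis vector_eq_ldot)
qed

text \<open>Linearity is known on the subspace \<open>X\<close> only, so the induction keeps every
  partial sum inside \<open>X\<close>. The general target type covers both Frechet derivatives and
  operators of the scale.\<close>

lemma additive_homogeneous_lincomb:
  fixes L :: "hvec \<Rightarrow> 'b::real_vector"
  assumes "\<forall>x\<in>X. \<forall>y\<in>X. L (x + y) = L x + L y" and "\<forall>c. \<forall>x\<in>X. L (c *\<^sub>R x) = c *\<^sub>R L x"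
    and "subspace X" and "\<And>i. v i \<in> X"
  shows "L (lincomb v a) = (\<Sum>i\<in>UNIV. (a $ i) *\<^sub>R L (v i))"
proof -
  have "L 0 = 0"
    using assms(2) \<open>subspace X\<close> by (metis scaleR_zero_left subspace_0)
  have "L (\<Sum>i\<in>A. (a $ i) *\<^sub>R v i) = (\<Sum>i\<in>A. (a $ i) *\<^sub>R L (v i))" for A
  proof (induction A rule: infinite_finite_induct)
    case (insert i A)
    have "(a $ i) *\<^sub>R v i \<in> X" "(\<Sum>i\<in>A. (a $ i) *\<^sub>R v i) \<in> X"
      using assms by (auto intro!: subspace_sum subspace_scale)
    with insert show ?case
      using assms(1,2,4) by simp
  qed (simp_all add: \<open>L 0 = 0\<close>)
  then show ?thesis by (simp add: lincomb_def)
qed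

section \<open>The mass matrix of a Galerkin space\<close>

locale galerkin_space = hilbert_scale \<psi> \<theta>
  for \<psi> :: "int \<Rightarrow> 'a::{real_inner, complete_space}" and \<theta> +
  fixes s :: int and v :: "'n::finite \<Rightarrow> hvec"
  assumes s_nonneg: "0 \<le> s" and v_in: "\<And>i. v i \<in> hs_space \<psi> \<theta> s"
    and inj_v: "inj v" and independent_v: "independent (range v)"
begin

abbreviation M :: "real ^ 'n ^ 'n" where "M \<equiv> mass_matrix v"

lemma hs_space_subset_dual: "hs_space \<psi> \<theta> s \<subseteq> hs_space \<psi> \<theta> (- s)"
  using hs_space_mono[OF basis weights] s_nonneg by simp

lemma v_in_dual: "v i \<in> hs_space \<psi> \<theta> (- s)"
  using v_in hs_space_subset_dual by blast

lemma lincomb_in: "lincomb v a \<in> hs_space \<psi> \<theta> s" "lincomb v a \<in> hs_space \<psi> \<theta> (- s)"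
  by (simp_all add: lincomb_in_hs_space v_in v_in_dual)

lemma mass_matrix_mult: "M *v a = (\<chi> i. pairing (lincomb v a) (v i))"
  by (simp add: vec_eq_iff matrix_vector_mult_def mass_matrix_def
      pairing_lincomb_left[of v s, OF v_in v_in_dual] mult.commute)

lemma pairing_lincomb_test:
  assumes "w \<in> hs_space \<psi> \<theta> (- s)"
  shows "pairing w (lincomb v x) = x \<bullet> (\<chi> i. pairing w (v i))"
  using pairing_lincomb_right[of v "- s" w] v_in assms by (simp add: inner_vec_def)

lemma transpose_mass_matrix: "transpose M = M"
  by (simp add: vec_eq_iff transpose_def mass_matrix_def pairing_commute)

lemma invertible_mass_matrix: "invertible M"
proof -
  have "x = 0" if "M *v x = 0" for x
  proof -
    have "pairing (lincomb v x) (lincomb v x) = 0"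
      using that by (simp add: pairing_lincomb_test lincomb_in mass_matrix_mult[symmetric])
    \<comment> \<open>Since \<open>0 \<le> s\<close>, the combination comes from an element of X_0,
      where the pairing is the inner product and therefore definite.\<close>
    moreover obtain y where "lincomb v x = hvec_of \<psi> y"
      using lincomb_in(1)[of x] hs_space_mono[OF basis weights s_nonneg] hs_space_0[OF basis] by blast
    ultimately have "lincomb v x = 0"
      using pairing_hvec_of[OF basis, of y y] linear_0[OF linear_hvec_of] by simp
    then show "x = 0"
      by (rule lincomb_eq_0D[OF inj_v independent_v])
  qed
  then show ?thesis
    unfolding invertible_left_inverse matrix_left_invertible_ker by blast
qed

lemma mass_matrix_inv_mult: "M *v (matrix_inv M *v x) = x" "matrix_inv M *v (M *v x) = x"
  using matrix_inv_mult[OF invertible_mass_matrix] by (simp_all add: matrix_vector_mul_assoc)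

lemma mass_matrix_mult_eq_iff: "M *v x = y \<longleftrightarrow> x = matrix_inv M *v y"
  using mass_matrix_inv_mult by metis

text \<open>By symmetry of \<open>M\<close>, the transposed inverse is again a left inverse of
  \<open>M\<close>, and a left inverse agrees with the inverse.\<close>

lemma transpose_matrix_inv_mass: "transpose (matrix_inv M) = matrix_inv M"
proof -
  note inv = matrix_inv_mult[OF invertible_mass_matrix]
  have "transpose (matrix_inv M) ** M = transpose (M ** matrix_inv M)"
    by (simp add: matrix_transpose_mul transpose_mass_matrix)
  then have "transpose (matrix_inv M) ** M = mat 1"
    by (simp add: inv transpose_mat)
  then have "transpose (matrix_inv M) ** (M ** matrix_inv M) = matrix_inv M"
    by (simp add: matrix_mul_assoc)
  then show ?thesis
    by (simp add: inv)
qed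

section \<open>Gradients of reduced functionals and the projection equations\<close>

lemma GDERIV_reduced_functional:
  assumes F: "frechet_deriv_on (hs_space \<psi> \<theta> s) (hs_norm \<theta> s) F (lincomb v a) L"
  shows "GDERIV (reduced_functional v F) a :> (\<chi> i. L (v i))"
proof -
  have L: "L (lincomb v h) = h \<bullet> (\<chi> i. L (v i))" for h
    using F additive_homogeneous_lincomb[of "hs_space \<psi> \<theta> s" L v h] v_in subspace_hs_space
    by (simp add: frechet_deriv_on_def inner_vec_def)
  \<comment> \<open>This is the chain rule by hand: \<open>C\<close> bounds the coordinate map into
    X_s, and the summand 1 makes it positive, so that \<open>\<epsilon> / C\<close> and
    \<open>\<delta> / C\<close> can be used.\<close>
  define C where "C = 1 + (\<Sum>i\<in>UNIV. hs_norm \<theta> s (v i))"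
  have "0 < C"
    using sum_nonneg[of UNIV "\<lambda>i. hs_norm \<theta> s (v i)"] hs_norm_nonneg by (simp add: C_def add_pos_nonneg)
  have C: "hs_norm \<theta> s (lincomb v h) \<le> C * norm h" for h
    using hs_norm_lincomb_le[of v s h] v_in norm_ge_zero[of h] unfolding C_def distrib_right by (simp add: add_increasing)
  have "\<exists>\<delta>>0. \<forall>y. norm (y - a) < \<delta> \<longrightarrow> norm (reduced_functional v F y - reduced_functional v F a -
      (y - a) \<bullet> (\<chi> i. L (v i))) \<le> \<epsilon> * norm (y - a)" if "0 < \<epsilon>" for \<epsilon>
  proof -
    have "0 < \<epsilon> / C" using that \<open>0 < C\<close> by simp
    then obtain \<delta> where "0 < \<delta>" and \<delta>: "\<And>\<xi>. \<xi> \<in> hs_space \<psi> \<theta> s \<Longrightarrow> hs_norm \<theta> s \<xi> < \<delta> \<Longrightarrow>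
        \<bar>F (lincomb v a + \<xi>) - F (lincomb v a) - L \<xi>\<bar> \<le> \<epsilon> / C * hs_norm \<theta> s \<xi>"
      using F unfolding frechet_deriv_on_def by meson
    have "norm (reduced_functional v F y - reduced_functional v F a - (y - a) \<bullet> (\<chi> i. L (v i)))
        \<le> \<epsilon> * norm (y - a)" if "norm (y - a) < \<delta> / C" for y
    proof -
      have "C * norm (y - a) < \<delta>"
        using that \<open>0 < C\<close> by (simp add: pos_less_divide_eq mult.commute)
      then have "hs_norm \<theta> s (lincomb v (y - a)) < \<delta>"
        using C[of "y - a"] by linarith
      from \<delta>[OF lincomb_in(1) this]
      have "\<bar>F (lincomb v y) - F (lincomb v a) - (y - a) \<bullet> (\<chi> i. L (v i))\<bar>
          \<le> \<epsilon> / C * hs_norm \<theta> s (lincomb v (y - a))"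
        unfolding L by (simp add: linear_diff[OF linear_lincomb])
      also have "\<dots> \<le> \<epsilon> / C * (C * norm (y - a))"
        using \<open>0 < \<epsilon> / C\<close> C by (intro mult_left_mono) auto
      finally show ?thesis
        using \<open>0 < C\<close> by (simp add: reduced_functional_def)
    qed
    with \<open>0 < \<delta>\<close> \<open>0 < C\<close> show ?thesis
      by (intro exI[of _ "\<delta> / C"]) auto
  qed
  then show ?thesis
    unfolding gderiv_def has_derivative_at_alt by (simp add: bounded_linear_inner_left)
qed

lemma gradient_reduced_functional:
  assumes "variational_derivative (hs_space \<psi> \<theta> s) (hs_norm \<theta> s) F (lincomb v a) g"
  shows "gradient (reduced_functional v F) a = (\<chi> i. pairing g (v i))"
proof -
  obtain L where "frechet_deriv_on (hs_space \<psi> \<theta> s) (hs_norm \<theta> s) F (lincomb v a) L"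
    and L: "\<And>\<xi>. \<xi> \<in> hs_space \<psi> \<theta> s \<Longrightarrow> pairing g \<xi> = L \<xi>"
    using assms unfolding variational_derivative_def by blast
  from gradient_eqI[OF GDERIV_reduced_functional[OF this(1)]] show ?thesis
    by (simp add: L v_in)
qed

text \<open>Passes between testing with the basis and testing with all of V_N: a vector is
  determined by its inner products with all \<open>x\<close>.\<close>

lemma eq_iff_test_lincomb:
  assumes "w \<in> hs_space \<psi> \<theta> (- s)"
  shows "(\<chi> i. pairing w (v i)) = g \<longleftrightarrow> (\<forall>x. pairing w (lincomb v x) = x \<bullet> g)"
  using assms by (simp add: pairing_lincomb_test vector_eq_ldot)

text \<open>Used twice, with \<open>g\<close> the variational derivative of each functional; the
  vector of its pairings with the basis is then the gradient of the reduced functional.\<close>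

lemma projection_test:
  assumes "g \<in> hs_space \<psi> \<theta> (- s)"
  shows "(\<forall>x. pairing (lincomb v b - g) (lincomb v x) = 0) \<longleftrightarrow> M *v b - (\<chi> i. pairing g (v i)) = 0"
proof -
  have "lincomb v b - g \<in> hs_space \<psi> \<theta> (- s)"
    using assms lincomb_in(2) by (intro subspace_diff[OF subspace_hs_space])
  from eq_iff_test_lincomb[OF this, of 0] show ?thesis
    using pairing_diff_left[OF lincomb_in(2) assms] v_in
    by (simp add: mass_matrix_mult vec_eq_iff)
qed

section \<open>Time derivatives of curves in the Galerkin space\<close>

lemma has_time_derivative_lincomb:
  assumes "(a has_vector_derivative a') (at t within T)"
  shows "has_time_derivative (hs_space \<psi> \<theta> (- s)) (hs_norm \<theta> (- s)) T
    (\<lambda>\<tau>. lincomb v (a \<tau>)) (lincomb v a') t"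
proof -
  define C where "C = (\<Sum>i\<in>UNIV. hs_norm \<theta> (- s) (v i))"
  \<comment> \<open>By linearity the error of the quotient in X_{-s} is the image of the error in
    coordinates, and the coordinate map is bounded with constant \<open>C\<close>.\<close>
  have q: "(1 / (\<tau> - t)) *\<^sub>R (lincomb v (a \<tau>) - lincomb v (a t)) - lincomb v a' =
      lincomb v ((1 / (\<tau> - t)) *\<^sub>R (a \<tau> - a t) - a')" for \<tau>
    by (simp add: linear_diff[OF linear_lincomb] linear_scale[OF linear_lincomb])
  have "((\<lambda>\<tau>. (1 / (\<tau> - t)) *\<^sub>R (a \<tau> - a t)) \<longlongrightarrow> a') (at t within T)"
    using assms unfolding has_vector_derivative_iff_tendsto .
  then have "((\<lambda>\<tau>. C * norm ((1 / (\<tau> - t)) *\<^sub>R (a \<tau> - a t) - a')) \<longlongrightarrow> 0) (at t within T)"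
    by (intro tendsto_mult_right_zero tendsto_norm_zero) (simp add: LIM_zero)
  then have "((\<lambda>\<tau>. hs_norm \<theta> (- s) (lincomb v ((1 / (\<tau> - t)) *\<^sub>R (a \<tau> - a t) - a'))) \<longlongrightarrow> 0) (at t within T)"
    by (rule tendsto_0_le[where K = 1])
      (use hs_norm_lincomb_le[of v "- s"] v_in_dual in
        \<open>auto simp: C_def hs_norm_nonneg intro!: always_eventually order_trans[OF _ abs_ge_self]\<close>)
  then show ?thesis
    by (simp add: has_time_derivative_def lincomb_in q)
qed

text \<open>Testing against the basis turns convergence in \<open>X\<^sub>-\<^sub>s\<close> into convergence of \<open>M a\<close>, and \<open>M\<close> is
  invertible.\<close>

lemma has_time_derivative_lincombD:
  assumes "has_time_derivative (hs_space \<psi> \<theta> (- s)) (hs_norm \<theta> (- s)) T (\<lambda>\<tau>. lincomb v (a \<tau>)) w t"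
  shows "(a has_vector_derivative matrix_inv M *v (\<chi> i. pairing w (v i))) (at t within T)"
proof -
  define q where "q \<tau> = (1 / (\<tau> - t)) *\<^sub>R (a \<tau> - a t)" for \<tau>
  have w: "w \<in> hs_space \<psi> \<theta> (- s)"
    and lim: "((\<lambda>\<tau>. hs_norm \<theta> (- s) (lincomb v (q \<tau>) - w)) \<longlongrightarrow> 0) (at t within T)"
    using assms
    by (simp_all add: has_time_derivative_def q_def linear_diff[OF linear_lincomb] linear_scale[OF linear_lincomb])
  have "((\<lambda>\<tau>. (M *v q \<tau>) $ i) \<longlongrightarrow> pairing w (v i)) (at t within T)" for i
  proof -
    \<comment> \<open>The limit \<open>w\<close> is known to lie in X_{-s} only; pairing with
      \<open>v i\<close> from X_s is continuous there by duality.\<close>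
    have "\<bar>pairing (lincomb v (q \<tau>) - w) (v i)\<bar> \<le> hs_norm \<theta> (- s) (lincomb v (q \<tau>) - w) * hs_norm \<theta> s (v i)" for \<tau>
      using pairing_bound(2)[OF basis weights, of _ "- s" "v i"] v_in lincomb_in(2) w
        subspace_diff[OF subspace_hs_space] by simp
    moreover have "pairing (lincomb v (q \<tau>) - w) (v i) = (M *v q \<tau>) $ i - pairing w (v i)" for \<tau>
      using pairing_diff_left[OF lincomb_in(2) w] v_in by (simp add: mass_matrix_mult)
    ultimately have "((\<lambda>\<tau>. (M *v q \<tau>) $ i - pairing w (v i)) \<longlongrightarrow> 0) (at t within T)"
      by (intro tendsto_0_le[OF lim, of _ "hs_norm \<theta> s (v i)"]) (simp add: hs_norm_nonneg)
    then show ?thesis by (simp add: LIM_zero_iff)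
  qed
  then have "((\<lambda>\<tau>. M *v q \<tau>) \<longlongrightarrow> (\<chi> i. pairing w (v i))) (at t within T)"
    by (intro vec_tendstoI) simp
  then have "((\<lambda>\<tau>. matrix_inv M *v (M *v q \<tau>)) \<longlongrightarrow> matrix_inv M *v (\<chi> i. pairing w (v i))) (at t within T)"
    by (rule bounded_linear.tendsto[OF matrix_vector_mul_bounded_linear])
  then show ?thesis
    by (simp add: has_vector_derivative_iff_tendsto mass_matrix_inv_mult q_def)
qed

section \<open>Operator matrices and the discrete evolution equation\<close>

context
  fixes L :: "hvec \<Rightarrow> hvec \<Rightarrow> hvec" and a :: "real ^ 'n" and X X'
  assumes lin: "linear_between X (hs_space \<psi> \<theta> (- s)) (L (lincomb v a))"
    and sym: "self_adjoint_pairing X X' (hs_space \<psi> \<theta> s) (L (lincomb v a))"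
    and sub: "hs_space \<psi> \<theta> s \<subseteq> X"
begin

lemma L_in: "L (lincomb v a) (lincomb v x) \<in> hs_space \<psi> \<theta> (- s)" "L (lincomb v a) (v i) \<in> hs_space \<psi> \<theta> (- s)"
  using lin sub lincomb_in(1)[of x] v_in unfolding linear_between_def by blast+

lemma L_lincomb: "L (lincomb v a) (lincomb v x) = lincomb (\<lambda>i. L (lincomb v a) (v i)) x"
  using additive_homogeneous_lincomb[of "hs_space \<psi> \<theta> s" "L (lincomb v a)" v x]
    lin sub v_in subspace_hs_space
  unfolding linear_between_def lincomb_def by blast

text \<open>The matrix applies the operator to the trial function, the mixed formulation to the test
  function; self-adjointness exchanges the two.\<close>

lemma inner_operator_matrix:
  "x \<bullet> (operator_matrix v L a *v c) = pairing (lincomb v c) (L (lincomb v a) (lincomb v x))"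
proof -
  have "(operator_matrix v L a *v c) $ i = pairing (lincomb v c) (L (lincomb v a) (v i))" for i
  proof -
    have "pairing (L (lincomb v a) (v j)) (v i) = pairing (v j) (L (lincomb v a) (v i))" for j
      using sym sub v_in unfolding self_adjoint_pairing_def by blast
    then show ?thesis
      using pairing_lincomb_left[of v s, OF v_in L_in(2)]
      by (simp add: matrix_vector_mult_def operator_matrix_def mult.commute)
  qed
  then show ?thesis
    unfolding L_lincomb using pairing_lincomb_right[of "\<lambda>i. L (lincomb v a) (v i)" s] L_in(2) lincomb_in(1)
    by (simp add: inner_vec_def)
qed

text \<open>The operator is frozen at \<open>a\<close>, independently of the curve
  \<open>\<alpha>\<close>; the application takes \<open>a\<close> to be the value of the curve at
  \<open>t\<close>. From left to right, \<open>w\<close> is the combination with coordinates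
  \<open>a'\<close>; conversely, \<open>a'\<close> is recovered from the pairings of
  \<open>w\<close> with the basis.\<close>

lemma galerkin_evolution_iff:
  "(\<exists>a'. (\<alpha> has_vector_derivative a') (at t within T) \<and> M *v a' = operator_matrix v L a *v c) \<longleftrightarrow>
    (\<exists>w. has_time_derivative (hs_space \<psi> \<theta> (- s)) (hs_norm \<theta> (- s)) T (\<lambda>\<tau>. lincomb v (\<alpha> \<tau>)) w t \<and>
      (\<forall>x. pairing w (lincomb v x) = pairing (lincomb v c) (L (lincomb v a) (lincomb v x))))"
  (is "?matrix \<longleftrightarrow> ?weak")
proof
  assume ?matrix
  then obtain a' where "(\<alpha> has_vector_derivative a') (at t within T)"
    and "M *v a' = operator_matrix v L a *v c" by blast
  then show ?weak
    by (intro exI[of _ "lincomb v a'"])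
      (simp add: has_time_derivative_lincomb eq_iff_test_lincomb lincomb_in mass_matrix_mult
        inner_operator_matrix)
next
  assume ?weak
  then obtain w where
    w: "has_time_derivative (hs_space \<psi> \<theta> (- s)) (hs_norm \<theta> (- s)) T (\<lambda>\<tau>. lincomb v (\<alpha> \<tau>)) w t"
    and test: "\<And>x. pairing w (lincomb v x) = x \<bullet> (operator_matrix v L a *v c)"
    by (auto simp: inner_operator_matrix)
  have "(\<chi> i. pairing w (v i)) = operator_matrix v L a *v c"
    using w test eq_iff_test_lincomb unfolding has_time_derivative_def by blast
  then show ?matrix
    using has_time_derivative_lincombD[OF w] by (metis mass_matrix_inv_mult(1))
qed

lemma symmetric_psd_G_hat:
  assumes "positive_semidefinite_pairing (hs_space \<psi> \<theta> s) (L (lincomb v a))"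
  shows "symmetric_psd (G_hat M (operator_matrix v L) a)"
proof -
  let ?G = "operator_matrix v L a"
  have "transpose ?G = ?G"
    using sym sub v_in unfolding vec_eq_iff transpose_def operator_matrix_def self_adjoint_pairing_def
    by (simp add: subset_iff) (metis pairing_commute)
  then have "transpose (G_hat M (operator_matrix v L) a) = G_hat M (operator_matrix v L) a"
    by (simp add: G_hat_def matrix_transpose_mul transpose_matrix_inv_mass matrix_mul_assoc)
  moreover have "0 \<le> x \<bullet> (G_hat M (operator_matrix v L) a *v x)" for x
  proof -
    let ?y = "matrix_inv M *v x"
    \<comment> \<open>The left factor \<open>matrix_inv M\<close> is symmetric and moves to the
      other argument of the inner product.\<close>
    have "x \<bullet> (G_hat M (operator_matrix v L) a *v x) = ?y \<bullet> (?G *v ?y)"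
      by (metis G_hat_def dot_lmul_matrix matrix_vector_mul_assoc transpose_matrix_inv_mass transpose_matrix_vector)
    also have "\<dots> = pairing (L (lincomb v a) (lincomb v ?y)) (lincomb v ?y)"
      by (simp add: inner_operator_matrix pairing_commute)
    also have "\<dots> \<ge> 0"
      using assms lincomb_in(1) unfolding positive_semidefinite_pairing_def by blast
    finally show ?thesis .
  qed
  ultimately show ?thesis
    by (simp add: symmetric_psd_def)
qed

end

end

section \<open>Continuous gradient flow, Galerkin system and reduced ODE\<close>

theorem proposition4p4:
  fixes \<psi> :: "int \<Rightarrow> 'a::{real_inner, complete_space}"
    and \<theta> :: "int \<Rightarrow> real"
    and X :: "int \<Rightarrow> hvec set"
    and nrm :: "int \<Rightarrow> hvec \<Rightarrow> real"
    and s d e :: nat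
    and \<H> \<S> :: "hvec \<Rightarrow> real"
    and \<delta>\<H> \<delta>\<S> :: "hvec \<Rightarrow> hvec"
    and \<J> \<G> :: "hvec \<Rightarrow> hvec \<Rightarrow> hvec"
    and V\<^sub>N :: "hvec set"
    and v :: "'n::finite \<Rightarrow> hvec"
    and \<T> :: "real set"
    and M :: "real ^ 'n ^ 'n"
    and J G :: "real ^ 'n \<Rightarrow> real ^ 'n ^ 'n"
    and H S :: "real ^ 'n \<Rightarrow> real"
  defines "X \<equiv> hs_space \<psi> \<theta>"
    and "nrm \<equiv> hs_norm \<theta>"
    and "M \<equiv> mass_matrix v"
    and "J \<equiv> operator_matrix v \<J>"
    and "G \<equiv> operator_matrix v \<G>"
    and "H \<equiv> reduced_functional v \<H>"
    and "S \<equiv> reduced_functional v \<S>"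
  assumes "hilbert_basis \<psi>" and "scale_weights \<theta>"
    and "0 < s" and "0 < d" and "0 < e" and "d \<le> 2 * s" and "e \<le> 2 * s"
    and "C1_functional (X s) (nrm s) \<H>"
    and "C1_functional (X s) (nrm s) \<S>"
    and "\<forall>u\<in>X s. \<delta>\<H> u \<in> X (- s + d) \<and> variational_derivative (X s) (nrm s) \<H> u (\<delta>\<H> u)"
    and "\<forall>u\<in>X s. \<delta>\<S> u \<in> X (- s + e) \<and> variational_derivative (X s) (nrm s) \<S> u (\<delta>\<S> u)"
    and "\<forall>u\<in>X s. linear_between (X (- s + d)) (X (- s)) (\<J> u) \<and>
           skew_adjoint_pairing (X (- s + d)) (X (int s - int d)) (X s) (\<J> u)"
    and "\<forall>u\<in>X s. linear_between (X (- s + e)) (X (- s)) (\<G> u) \<and>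
           self_adjoint_pairing (X (- s + e)) (X (int s - int e)) (X s) (\<G> u) \<and>
           positive_semidefinite_pairing (X s) (\<G> u)"
    and "inj v" and "independent (range v)" and "span (range v) = V\<^sub>N" and "V\<^sub>N \<subseteq> X s"
    and "is_interval \<T>" and "0 \<in> \<T>" and "\<T> \<noteq> {0}"
    and J_zero: "\<forall>u\<in>X s. \<forall>z\<in>X (- s + d). \<J> u z = 0"
  shows
    "(\<forall>u z y. mixed_solution (X (- s)) (nrm (- s)) \<T> (\<lambda>_ _. 0) \<G> \<delta>\<H> \<delta>\<S>
                (X s) (X (- s + d)) (X (- s + e)) (X s) u z y \<longleftrightarrow>
        evolution_solution (X (- s)) (nrm (- s)) (X s) \<T> (\<lambda>u. \<G> u (\<delta>\<S> u)) u \<and>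
        (\<forall>t\<in>\<T>. z t = \<delta>\<H> (u t) \<and> y t = \<delta>\<S> (u t))) \<and>
     (\<forall>a b c. semi_discrete_solution M J G H S \<T> a b c \<longleftrightarrow>
        galerkin_mixed_solution (X (- s)) (nrm (- s)) \<T> (\<lambda>_ _. 0) \<G> \<delta>\<H> \<delta>\<S> V\<^sub>N
          (\<lambda>t. lincomb v (a t)) (\<lambda>t. lincomb v (b t)) (\<lambda>t. lincomb v (c t))) \<and>
     invertible M \<and>
     (\<forall>a b c. semi_discrete_solution M J G H S \<T> a b c \<longleftrightarrow>
        ode_solution (\<lambda>x. G_hat M G x *v gradient S x) \<T> a \<and>
        (\<forall>t\<in>\<T>. b t = matrix_inv M *v gradient H (a t) \<and>
                 c t = matrix_inv M *v gradient S (a t))) \<and>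
     (\<forall>a. (\<exists>b c. semi_discrete_solution M J G H S \<T> a b c) \<longleftrightarrow>
        ode_solution (\<lambda>x. G_hat M G x *v gradient S x) \<T> a) \<and>
     (\<forall>x. symmetric_psd (G_hat M G x))"
proof -
  note hyps = assms(8-)
  interpret galerkin_space \<psi> \<theta> "int s" v
  proof
    show "v i \<in> hs_space \<psi> \<theta> (int s)" for i
      using \<open>span (range v) = V\<^sub>N\<close> \<open>V\<^sub>N \<subseteq> X s\<close> span_base[of "v i" "range v"] by (auto simp: X_def)
  qed (use hyps in auto)
  have V: "V\<^sub>N = range (lincomb v)"
    using \<open>span (range v) = V\<^sub>N\<close> by (simp add: range_lincomb)
  have mono: "X p \<subseteq> X q" if "q \<le> p" for p q
    unfolding X_def by (rule hs_space_mono[OF basis weights that])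
  \<comment> \<open>The bounds \<open>d \<le> 2 * s\<close> and \<open>e \<le> 2 * s\<close> give
    \<open>- s + d \<le> s\<close> and \<open>- s + e \<le> s\<close>, so the operators can be
    applied to test functions.\<close>
  have lift: "X s \<subseteq> X (- s + d)" "X s \<subseteq> X (- s + e)"
    and drop: "X (- s + d) \<subseteq> X (- s)" "X (- s + e) \<subseteq> X (- s)"
    using \<open>d \<le> 2 * s\<close> \<open>e \<le> 2 * s\<close> by (auto intro!: mono)
  have u: "lincomb v x \<in> X s" for x
    by (simp add: X_def lincomb_in)
  have \<G>: "linear_between (X (- s + e)) (hs_space \<psi> \<theta> (- s)) (\<G> w)"
    "self_adjoint_pairing (X (- s + e)) (X (int s - int e)) (hs_space \<psi> \<theta> s) (\<G> w)"
    "positive_semidefinite_pairing (hs_space \<psi> \<theta> s) (\<G> w)" if "w \<in> X s" for w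
    using hyps that by (auto simp: X_def)
  have \<delta>\<H>: "\<delta>\<H> w \<in> X (- s)" "variational_derivative (hs_space \<psi> \<theta> s) (hs_norm \<theta> s) \<H> w (\<delta>\<H> w)"
    and \<delta>\<S>: "\<delta>\<S> w \<in> X (- s)" "variational_derivative (hs_space \<psi> \<theta> s) (hs_norm \<theta> s) \<S> w (\<delta>\<S> w)"
    if "w \<in> X s" for w
    using hyps that drop by (auto simp: X_def nrm_def)
  have M: "M = mass_matrix v" by (simp add: M_def)
  have J0: "J x = 0" for x
  proof -
    have "\<J> (lincomb v x) (v j) = 0" for j
      using J_zero u[of x] v_in[of j] lift(1) by (auto simp: X_def)
    then show ?thesis
      by (simp add: J_def operator_matrix_def vec_eq_iff)
  qed

  have continuous: "mixed_solution (X (- s)) (nrm (- s)) \<T> (\<lambda>_ _. 0) \<G> \<delta>\<H> \<delta>\<S>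
      (X s) (X (- s + d)) (X (- s + e)) (X s) u z y \<longleftrightarrow>
    evolution_solution (X (- s)) (nrm (- s)) (X s) \<T> (\<lambda>u. \<G> u (\<delta>\<S> u)) u \<and>
      (\<forall>t\<in>\<T>. z t = \<delta>\<H> (u t) \<and> y t = \<delta>\<S> (u t))" (is "?mixed \<longleftrightarrow> ?strong") for u z y
  proof
    assume mixed: ?mixed
    have "u t \<in> X s \<and> has_time_derivative (X (- s)) (nrm (- s)) \<T> u (\<G> (u t) (\<delta>\<S> (u t))) t \<and>
        z t = \<delta>\<H> (u t) \<and> y t = \<delta>\<S> (u t)" if t: "t \<in> \<T>" for t
    proof -
      obtain w where w: "has_time_derivative (X (- s)) (nrm (- s)) \<T> u w t"
        and test: "\<And>x. x \<in> X s \<Longrightarrow> pairing w x = pairing (y t) (\<G> (u t) x)"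
          "\<And>x. x \<in> X s \<Longrightarrow> pairing (z t - \<delta>\<H> (u t)) x = 0"
          "\<And>x. x \<in> X s \<Longrightarrow> pairing (y t - \<delta>\<S> (u t)) x = 0"
        and in_X: "u t \<in> X s" "y t \<in> X (- s + e)"
        using mixed t unfolding mixed_solution_def by auto
      \<comment> \<open>Vanishing against X_s forces equality as formal series, so the auxiliary
        unknowns are exactly the variational derivatives.\<close>
      have eq: "z t - \<delta>\<H> (u t) = 0" "y t - \<delta>\<S> (u t) = 0"
        using test(2,3) by (intro hvec_eqI_pairing[of s]; simp add: X_def)+
      \<comment> \<open>Self-adjointness moves the operator from the test function to
        \<open>y t\<close>; since X_s separates formal series, the weak equation becomes the strong
        one.\<close>
      moreover have "w = \<G> (u t) (y t)"
      proof (rule hvec_eqI_pairing[of s])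
        fix x assume "x \<in> hs_space \<psi> \<theta> s"
        then show "pairing w x = pairing (\<G> (u t) (y t)) x"
          using test(1) \<G>(2)[OF in_X(1)] in_X(2) by (simp add: X_def self_adjoint_pairing_def)
      qed
      ultimately show ?thesis
        using w in_X(1) by simp
    qed
    then show ?strong
      by (simp add: evolution_solution_def)
  next
    assume strong: ?strong
    show ?mixed
      unfolding mixed_solution_def
    proof (intro ballI conjI)
      fix t assume t: "t \<in> \<T>"
      show u: "u t \<in> X s"
        using strong t by (simp add: evolution_solution_def)
      \<comment> \<open>Here the assumed regularity of the variational derivatives enters.\<close>
      show z: "z t \<in> X (- s + d)" and y: "y t \<in> X (- s + e)"
        using strong t u hyps by auto
      show "\<exists>w. has_time_derivative (X (- s)) (nrm (- s)) \<T> u w t \<and>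
          (\<forall>x\<in>X s. pairing w x = - pairing (z t) 0 + pairing (y t) (\<G> (u t) x))"
        using strong t \<G>(2)[OF u] y
        by (intro exI[of _ "\<G> (u t) (y t)"])
          (auto simp: evolution_solution_def self_adjoint_pairing_def X_def)
    qed (use strong in auto)
  qed

  have semi: "semi_discrete_solution M J G H S \<T> a b c \<longleftrightarrow>
    (\<forall>t\<in>\<T>. (\<exists>a'. (a has_vector_derivative a') (at t within \<T>) \<and> M *v a' = G (a t) *v c t) \<and>
      M *v b t - gradient H (a t) = 0 \<and> M *v c t - gradient S (a t) = 0)" for a b c
    by (simp add: semi_discrete_solution_def J0)

  have galerkin: "semi_discrete_solution M J G H S \<T> a b c \<longleftrightarrow>
    galerkin_mixed_solution (X (- s)) (nrm (- s)) \<T> (\<lambda>_ _. 0) \<G> \<delta>\<H> \<delta>\<S> V\<^sub>N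
      (\<lambda>t. lincomb v (a t)) (\<lambda>t. lincomb v (b t)) (\<lambda>t. lincomb v (c t))" for a b c
  proof -
    \<comment> \<open>The three equations are matched one at a time. As V_N is the range of
      \<open>lincomb v\<close>, test functions are parametrised by coefficient vectors and
      membership of the unknowns is automatic.\<close>
    have "(\<exists>a'. (a has_vector_derivative a') (at t within \<T>) \<and> M *v a' = G (a t) *v c t) \<longleftrightarrow>
        (\<exists>w. has_time_derivative (X (- s)) (nrm (- s)) \<T> (\<lambda>t. lincomb v (a t)) w t \<and>
          (\<forall>x. pairing w (lincomb v x) = pairing (lincomb v (c t)) (\<G> (lincomb v (a t)) (lincomb v x))))" for t
      unfolding M G_def X_def nrm_def
      by (rule galerkin_evolution_iff) (use \<G>[OF u] lift(2) in \<open>auto simp: X_def\<close>)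
    moreover have "M *v b t - gradient H (a t) = 0 \<longleftrightarrow>
        (\<forall>x. pairing (lincomb v (b t) - \<delta>\<H> (lincomb v (a t))) (lincomb v x) = 0)" for t
      unfolding M H_def gradient_reduced_functional[OF \<delta>\<H>(2)[OF u]]
      using \<delta>\<H>(1)[OF u] by (intro projection_test[symmetric]) (simp add: X_def)
    moreover have "M *v c t - gradient S (a t) = 0 \<longleftrightarrow>
        (\<forall>x. pairing (lincomb v (c t) - \<delta>\<S> (lincomb v (a t))) (lincomb v x) = 0)" for t
      unfolding M S_def gradient_reduced_functional[OF \<delta>\<S>(2)[OF u]]
      using \<delta>\<S>(1)[OF u] by (intro projection_test[symmetric]) (simp add: X_def)
    ultimately show ?thesis
      unfolding semi galerkin_mixed_solution_def mixed_solution_def V by simp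
  qed

  \<comment> \<open>Inverting \<open>M\<close> solves each equation: inserting \<open>c t\<close>
    into the first one places one inverse on each side of \<open>G (a t)\<close>, which is
    \<open>G_hat\<close>.\<close>
  have ode: "semi_discrete_solution M J G H S \<T> a b c \<longleftrightarrow>
    ode_solution (\<lambda>x. G_hat M G x *v gradient S x) \<T> a \<and>
    (\<forall>t\<in>\<T>. b t = matrix_inv M *v gradient H (a t) \<and> c t = matrix_inv M *v gradient S (a t))" for a b c
    unfolding semi unfolding ode_solution_def M G_hat_def right_minus_eq mass_matrix_mult_eq_iff
    by (auto simp: matrix_vector_mul_assoc matrix_mul_assoc)

  have "(\<exists>b c. semi_discrete_solution M J G H S \<T> a b c) \<longleftrightarrow>
    ode_solution (\<lambda>x. G_hat M G x *v gradient S x) \<T> a" for a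
    \<comment> \<open>One schematic witness serves for both \<open>b\<close> and \<open>c\<close>;
      the hole stands for \<open>H\<close> and \<open>S\<close> respectively.\<close>
    unfolding ode by (auto intro!: exI[of _ "\<lambda>t. matrix_inv M *v gradient _ (a t)"])
  moreover have "symmetric_psd (G_hat M G x)" for x
    unfolding M G_def
    by (rule symmetric_psd_G_hat) (use \<G>[OF u] lift(2) in \<open>auto simp: X_def\<close>)
  moreover have "invertible M"
    unfolding M by (rule invertible_mass_matrix)
  ultimately show ?thesis
    using continuous galerkin ode by blast
qed

end
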